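(* Let $(\mathscr{C},\mathbb{E},\mathfrak{s})$ be an extriangulated category such that $\mathscr{C}$ is small, and let $\hat{\mathscr{C}}$ be the weak idempotent completion of $\mathscr{C}$. Then $\hat{\mathscr{C}}$ is extriangulated, i.e. there are a biadditive functor $\hat{\mathbb{E}}\colon\hat{\mathscr{C}}^{\mathrm{op}}\times\hat{\mathscr{C}}\to Ab$ and a correspondence $\hat{\mathfrak{s}}$ such that $(\hat{\mathscr{C}},\hat{\mathbb{E}},\hat{\mathfrak{s}})$ is an extriangulated category. Moreover, the embedding $j_{\mathscr{C}}\colon\mathscr{C}\to\hat{\mathscr{C}}$, $A\mapsto(A,1_A)$, $f\mapsto f$, is an extriangulated functor $(\mathscr{C},\mathbb{E},\mathfrak{s})\to(\hat{\mathscr{C}},\hat{\mathbb{E}},\hat{\mathfrak{s}})$.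
   Context: **Weak idempotent completion.** For a small additive category $\mathscr{C}$, the category $\hat{\mathscr{C}}$ has as objects the pairs $(A,p)$ with $A\in\mathscr{C}$ and $p\colon A\to A$ an idempotent that splits, i.e. $p=cr$ for some $r\colon A\to X$ and $c\colon X\to A$ in $\mathscr{C}$ with $rc=1_X$. A morphism $(A,p)\to(B,q)$ is a morphism $\sigma\colon A\to B$ in $\mathscr{C}$ with $\sigma p=q\sigma=\sigma$; composition is that of $\mathscr{C}$, $1_{(A,p)}=p$, and $(A,p)\oplus(B,q)=(A\oplus B,p\oplus q)$. **Extriangulated categories (Nakaoka–Palu).** Let $\mathscr{C}$ be additive and $\mathbb{E}\colon\mathscr{C}^{\mathrm{op}}\times\mathscr{C}\to Ab$ a biadditive functor ($Ab$ = abelian groups). An $\mathbb{E}$-extension is an element $\delta\in\mathbb{E}(C,A)$. For $a\colon A\to A'$ and $c\colon C'\to C$ write $a_*\delta=\mathbb{E}(C,a)(\delta)$, $c^*\delta=\mathbb{E}(c,A)(\delta)$. A morphism of extensions $(a,c)\colon\delta\to\delta'$, with $\delta\in\mathbb{E}(C,A)$, $\delta'\in\mathbb{E}(C',A')$, is a pair $a\colon A\to A'$, $c\colon C\to C'$ with $a_*\delta=c^*\delta'$. The extension $\delta\oplus\delta'\in\mathbb{E}(C\oplus C',A\oplus A')$ corresponds to $(\delta,0,0,\delta')$ under biadditivity. Sequences $A\xrightarrow{x}B\xrightarrow{y}C$ and $A\xrightarrow{x'}B'\xrightarrow{y'}C$ are equivalent if there is an isomorphism $b\colon B\to B'$ with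 $bx=x'$, $y'b=y$; the class is written $[A\xrightarrow{x}B\xrightarrow{y}C]$. A realisation $\mathfrak{s}$ assigns to each $\delta\in\mathbb{E}(C,A)$ a class $\mathfrak{s}(\delta)=[A\xrightarrow{x}B\xrightarrow{y}C]$ (the sequence is then said to realise $\delta$) such that whenever $\mathfrak{s}(\delta)=[A\xrightarrow{x}B\xrightarrow{y}C]$, $\mathfrak{s}(\delta')=[A'\xrightarrow{x'}B'\xrightarrow{y'}C']$ and $(a,c)\colon\delta\to\delta'$ is a morphism of extensions, there is $b\colon B\to B'$ with $bx=x'a$ and $y'b=cy$; one says $(a,b,c)$ realises $(a,c)$. It is additive if $\mathfrak{s}(0)=[A\to A\oplus C\to C]$ (canonical inclusion and projection) and $\mathfrak{s}(\delta\oplus\delta')=\mathfrak{s}(\delta)\oplus\mathfrak{s}(\delta')$ (termwise direct sum). The triple $(\mathscr{C},\mathbb{E},\mathfrak{s})$ is extriangulated if: (ET1) $\mathbb{E}$ is a biadditive functor. (ET2) $\mathfrak{s}$ is an additive realisation of $\mathbb{E}$. (ET3) If $\delta,\delta'$ are realised by $A\xrightarrow{x}B\xrightarrow{y}C$ and $A'\xrightarrow{x'}B'\xrightarrow{y'}C'$, and $a\colon A\to A'$, $b\colon B\to B'$ satisfy $bx=x'a$, then there is $c\colon C\to C'$ such that $(a,c)\colon\delta\to\delta'$ is a morphism of extensions realised by $(a,b,c)$. (ET3)$^{\mathrm{op}}$ Dually: given $b,c$ with $cy=y'b$ there is $a$ such that $(a,c)\colon\delta\to\delta'$ is a morphism of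 extensions realised by $(a,b,c)$. (ET4) If $\delta\in\mathbb{E}(D,A)$ and $\delta'\in\mathbb{E}(F,B)$ are realised by $A\xrightarrow{f}B\xrightarrow{f'}D$ and $B\xrightarrow{g}C\xrightarrow{g'}F$, then there are an object $E$, morphisms $h\colon A\to C$, $h'\colon C\to E$, $d\colon D\to E$, $e\colon E\to F$ with $h=gf$, $h'g=df'$, $eh'=g'$, and $\delta''\in\mathbb{E}(E,A)$ realised by $A\xrightarrow{h}C\xrightarrow{h'}E$, such that $\mathfrak{s}(f'_*\delta')=[D\xrightarrow{d}E\xrightarrow{e}F]$, $d^*\delta''=\delta$, $f_*\delta''=e^*\delta'$. (ET4)$^{\mathrm{op}}$ If $\delta\in\mathbb{E}(B,D)$ and $\delta'\in\mathbb{E}(C,F)$ are realised by $D\xrightarrow{f'}A\xrightarrow{f}B$ and $F\xrightarrow{g'}B\xrightarrow{g}C$, then there are an object $E$, morphisms $d\colon D\to E$, $e\colon E\to F$, $h'\colon E\to A$, $h\colon A\to C$ with $h=gf$, $h'd=f'$, $fh'=g'e$, and $\delta''\in\mathbb{E}(C,E)$ realised by $E\xrightarrow{h'}A\xrightarrow{h}C$, such that $\mathfrak{s}(g'^*\delta)=[D\xrightarrow{d}E\xrightarrow{e}F]$, $e_*\delta''=\delta'$, $d_*\delta=g^*\delta''$. **Extriangulated functor.** A covariant additive functor $F\colon\mathscr{C}\to\mathscr{C}'$ between extriangulated categories $(\mathscr{C},\mathbb{E},\mathfrak{s})$, $(\mathscr{C}',\mathbb{E}',\mathfrak{s}')$ is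 extriangulated if there is a natural transformation $\Gamma\colon\mathbb{E}\Rightarrow\mathbb{E}'(F^{\mathrm{op}}-,F-)$ of functors $\mathscr{C}^{\mathrm{op}}\times\mathscr{C}\to Ab$ such that $\mathfrak{s}(\delta)=[X\xrightarrow{x}Y\xrightarrow{y}Z]$ implies $\mathfrak{s}'(\Gamma_{(Z,X)}(\delta))=[F(X)\xrightarrow{F(x)}F(Y)\xrightarrow{F(y)}F(Z)]$. *)

theory Defs
  imports "HOL-Algebra.Group"
begin

section \<open>Additive categories\<close>

text \<open>
  A small category has its objects in a set over the type \<open>'o\<close>. Hom-sets are indexed by their
  endpoints and need not be disjoint, so composition carries the three objects involved:
  \<open>Comp \<C> A B D g f\<close> is \<open>g \<circ> f\<close> for \<open>f : A \<rightarrow> B\<close> and \<open>g : B \<rightarrow> D\<close>.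
  \<open>Hom \<C> A B\<close> is the abelian group of morphisms; HOL-Algebra writes it multiplicatively, so
  \<open>\<otimes>\<close> is the sum and \<open>\<one>\<close> the zero morphism. Direct sums are chosen as part of the structure.
\<close>

record ('o, 'm) add_cat =
  Obj :: "'o set"
  Hom :: "'o \<Rightarrow> 'o \<Rightarrow> 'm monoid"
  Comp :: "'o \<Rightarrow> 'o \<Rightarrow> 'o \<Rightarrow> 'm \<Rightarrow> 'm \<Rightarrow> 'm"
  Ident :: "'o \<Rightarrow> 'm"
  Dsum :: "'o \<Rightarrow> 'o \<Rightarrow> 'o"
  In1 :: "'o \<Rightarrow> 'o \<Rightarrow> 'm"
  In2 :: "'o \<Rightarrow> 'o \<Rightarrow> 'm"
  Pr1 :: "'o \<Rightarrow> 'o \<Rightarrow> 'm"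
  Pr2 :: "'o \<Rightarrow> 'o \<Rightarrow> 'm"

abbreviation Mor :: "('o, 'm) add_cat \<Rightarrow> 'o \<Rightarrow> 'o \<Rightarrow> 'm set"
  where "Mor \<C> A B \<equiv> carrier (Hom \<C> A B)"

locale additive_category =
  fixes \<C> :: "('o, 'm) add_cat"
  assumes Ident_closed: "A \<in> Obj \<C> \<Longrightarrow> Ident \<C> A \<in> Mor \<C> A A"
    and Comp_closed:
      "\<lbrakk>A \<in> Obj \<C>; B \<in> Obj \<C>; D \<in> Obj \<C>; f \<in> Mor \<C> A B; g \<in> Mor \<C> B D\<rbrakk>
        \<Longrightarrow> Comp \<C> A B D g f \<in> Mor \<C> A D"
    and Comp_assoc:
      "\<lbrakk>A \<in> Obj \<C>; B \<in> Obj \<C>; D \<in> Obj \<C>; K \<in> Obj \<C>;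
        f \<in> Mor \<C> A B; g \<in> Mor \<C> B D; h \<in> Mor \<C> D K\<rbrakk>
        \<Longrightarrow> Comp \<C> A B K (Comp \<C> B D K h g) f = Comp \<C> A D K h (Comp \<C> A B D g f)"
    and Comp_Ident_right:
      "\<lbrakk>A \<in> Obj \<C>; B \<in> Obj \<C>; f \<in> Mor \<C> A B\<rbrakk> \<Longrightarrow> Comp \<C> A A B f (Ident \<C> A) = f"
    and Comp_Ident_left:
      "\<lbrakk>A \<in> Obj \<C>; B \<in> Obj \<C>; f \<in> Mor \<C> A B\<rbrakk> \<Longrightarrow> Comp \<C> A B B (Ident \<C> B) f = f"
    and Hom_comm_group: "\<lbrakk>A \<in> Obj \<C>; B \<in> Obj \<C>\<rbrakk> \<Longrightarrow> comm_group (Hom \<C> A B)"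
    and Comp_add_right:
      "\<lbrakk>A \<in> Obj \<C>; B \<in> Obj \<C>; D \<in> Obj \<C>;
        f \<in> Mor \<C> A B; f' \<in> Mor \<C> A B; g \<in> Mor \<C> B D\<rbrakk>
        \<Longrightarrow> Comp \<C> A B D g (f \<otimes>\<^bsub>Hom \<C> A B\<^esub> f') =
            Comp \<C> A B D g f \<otimes>\<^bsub>Hom \<C> A D\<^esub> Comp \<C> A B D g f'"
    and Comp_add_left:
      "\<lbrakk>A \<in> Obj \<C>; B \<in> Obj \<C>; D \<in> Obj \<C>;
        f \<in> Mor \<C> A B; g \<in> Mor \<C> B D; g' \<in> Mor \<C> B D\<rbrakk>
        \<Longrightarrow> Comp \<C> A B D (g \<otimes>\<^bsub>Hom \<C> B D\<^esub> g') f =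
            Comp \<C> A B D g f \<otimes>\<^bsub>Hom \<C> A D\<^esub> Comp \<C> A B D g' f"
    and zero_object:
      "\<exists>Z\<in>Obj \<C>. \<forall>A\<in>Obj \<C>. (\<exists>!f. f \<in> Mor \<C> Z A) \<and> (\<exists>!f. f \<in> Mor \<C> A Z)"
    and Dsum_closed: "\<lbrakk>A \<in> Obj \<C>; B \<in> Obj \<C>\<rbrakk> \<Longrightarrow> Dsum \<C> A B \<in> Obj \<C>"
    and In1_closed: "\<lbrakk>A \<in> Obj \<C>; B \<in> Obj \<C>\<rbrakk> \<Longrightarrow> In1 \<C> A B \<in> Mor \<C> A (Dsum \<C> A B)"
    and In2_closed: "\<lbrakk>A \<in> Obj \<C>; B \<in> Obj \<C>\<rbrakk> \<Longrightarrow> In2 \<C> A B \<in> Mor \<C> B (Dsum \<C> A B)"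
    and Pr1_closed: "\<lbrakk>A \<in> Obj \<C>; B \<in> Obj \<C>\<rbrakk> \<Longrightarrow> Pr1 \<C> A B \<in> Mor \<C> (Dsum \<C> A B) A"
    and Pr2_closed: "\<lbrakk>A \<in> Obj \<C>; B \<in> Obj \<C>\<rbrakk> \<Longrightarrow> Pr2 \<C> A B \<in> Mor \<C> (Dsum \<C> A B) B"
    and Pr1_In1:
      "\<lbrakk>A \<in> Obj \<C>; B \<in> Obj \<C>\<rbrakk>
        \<Longrightarrow> Comp \<C> A (Dsum \<C> A B) A (Pr1 \<C> A B) (In1 \<C> A B) = Ident \<C> A"
    and Pr2_In2:
      "\<lbrakk>A \<in> Obj \<C>; B \<in> Obj \<C>\<rbrakk>
        \<Longrightarrow> Comp \<C> B (Dsum \<C> A B) B (Pr2 \<C> A B) (In2 \<C> A B) = Ident \<C> B"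
    and Pr2_In1:
      "\<lbrakk>A \<in> Obj \<C>; B \<in> Obj \<C>\<rbrakk>
        \<Longrightarrow> Comp \<C> A (Dsum \<C> A B) B (Pr2 \<C> A B) (In1 \<C> A B) = \<one>\<^bsub>Hom \<C> A B\<^esub>"
    and Pr1_In2:
      "\<lbrakk>A \<in> Obj \<C>; B \<in> Obj \<C>\<rbrakk>
        \<Longrightarrow> Comp \<C> B (Dsum \<C> A B) A (Pr1 \<C> A B) (In2 \<C> A B) = \<one>\<^bsub>Hom \<C> B A\<^esub>"
    and In_Pr_sum:
      "\<lbrakk>A \<in> Obj \<C>; B \<in> Obj \<C>\<rbrakk>
        \<Longrightarrow> Comp \<C> (Dsum \<C> A B) A (Dsum \<C> A B) (In1 \<C> A B) (Pr1 \<C> A B)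
            \<otimes>\<^bsub>Hom \<C> (Dsum \<C> A B) (Dsum \<C> A B)\<^esub>
            Comp \<C> (Dsum \<C> A B) B (Dsum \<C> A B) (In2 \<C> A B) (Pr2 \<C> A B)
            = Ident \<C> (Dsum \<C> A B)"

text \<open>\<open>f \<oplus> f' : A \<oplus> A' \<rightarrow> B \<oplus> B'\<close> for \<open>f : A \<rightarrow> B\<close> and \<open>f' : A' \<rightarrow> B'\<close>.\<close>

definition dsum_mor :: "('o, 'm) add_cat \<Rightarrow> 'o \<Rightarrow> 'o \<Rightarrow> 'o \<Rightarrow> 'o \<Rightarrow> 'm \<Rightarrow> 'm \<Rightarrow> 'm"
  where "dsum_mor \<C> A B A' B' f f' =
    Comp \<C> (Dsum \<C> A A') B (Dsum \<C> B B') (In1 \<C> B B')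
        (Comp \<C> (Dsum \<C> A A') A B f (Pr1 \<C> A A'))
    \<otimes>\<^bsub>Hom \<C> (Dsum \<C> A A') (Dsum \<C> B B')\<^esub>
    Comp \<C> (Dsum \<C> A A') B' (Dsum \<C> B B') (In2 \<C> B B')
        (Comp \<C> (Dsum \<C> A A') A' B' f' (Pr2 \<C> A A'))"

definition is_iso :: "('o, 'm) add_cat \<Rightarrow> 'o \<Rightarrow> 'o \<Rightarrow> 'm \<Rightarrow> bool"
  where "is_iso \<C> A B f \<longleftrightarrow> f \<in> Mor \<C> A B \<and>
    (\<exists>g\<in>Mor \<C> B A. Comp \<C> A B A g f = Ident \<C> A \<and> Comp \<C> B A B f g = Ident \<C> B)"


section \<open>Weak idempotent completion\<close>

definition split_idempotent :: "('o, 'm) add_cat \<Rightarrow> 'o \<Rightarrow> 'm \<Rightarrow> bool"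
  where "split_idempotent \<C> A p \<longleftrightarrow> p \<in> Mor \<C> A A \<and> Comp \<C> A A A p p = p \<and>
    (\<exists>X\<in>Obj \<C>. \<exists>r\<in>Mor \<C> A X. \<exists>c\<in>Mor \<C> X A.
      p = Comp \<C> A X A c r \<and> Comp \<C> X A X r c = Ident \<C> X)"

definition wic :: "('o, 'm) add_cat \<Rightarrow> ('o \<times> 'm, 'm) add_cat"
  where "wic \<C> = \<lparr>
    Obj = {(A, p). A \<in> Obj \<C> \<and> split_idempotent \<C> A p},
    Hom = (\<lambda>(A, p) (B, q). \<lparr>
      carrier = {\<sigma> \<in> Mor \<C> A B. Comp \<C> A A B \<sigma> p = \<sigma> \<and> Comp \<C> A B B q \<sigma> = \<sigma>},
      monoid.mult = monoid.mult (Hom \<C> A B),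
      one = \<one>\<^bsub>Hom \<C> A B\<^esub>\<rparr>),
    Comp = (\<lambda>(A, p) (B, q) (D, t). Comp \<C> A B D),
    Ident = (\<lambda>(A, p). p),
    Dsum = (\<lambda>(A, p) (B, q). (Dsum \<C> A B, dsum_mor \<C> A A B B p q)),
    In1 = (\<lambda>(A, p) (B, q). Comp \<C> A A (Dsum \<C> A B) (In1 \<C> A B) p),
    In2 = (\<lambda>(A, p) (B, q). Comp \<C> B B (Dsum \<C> A B) (In2 \<C> A B) q),
    Pr1 = (\<lambda>(A, p) (B, q). Comp \<C> (Dsum \<C> A B) A A p (Pr1 \<C> A B)),
    Pr2 = (\<lambda>(A, p) (B, q). Comp \<C> (Dsum \<C> A B) B B q (Pr2 \<C> A B))\<rparr>"


section \<open>Biadditive functors and extensions\<close>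

text \<open>
  \<open>Ext E C A\<close> is the abelian group \<open>E(C, A)\<close>, again in multiplicative notation. For
  \<open>c : C' \<rightarrow> C\<close> and \<open>a : A \<rightarrow> A'\<close>, \<open>ExtMap E C A C' A' c a\<close> is \<open>E(c, a) : E(C, A) \<rightarrow> E(C', A')\<close>;
  its values outside the carrier of \<open>E(C, A)\<close> are irrelevant.
\<close>

record ('o, 'm, 'e) ext_bifunctor =
  Ext :: "'o \<Rightarrow> 'o \<Rightarrow> 'e monoid"
  ExtMap :: "'o \<Rightarrow> 'o \<Rightarrow> 'o \<Rightarrow> 'o \<Rightarrow> 'm \<Rightarrow> 'm \<Rightarrow> 'e \<Rightarrow> 'e"

definition push ::
    "('o, 'm) add_cat \<Rightarrow> ('o, 'm, 'e) ext_bifunctor \<Rightarrow> 'o \<Rightarrow> 'o \<Rightarrow> 'o \<Rightarrow> 'm \<Rightarrow> 'e \<Rightarrow> 'e"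
  where "push \<C> E C A A' a \<delta> = ExtMap E C A C A' (Ident \<C> C) a \<delta>"

definition pull ::
    "('o, 'm) add_cat \<Rightarrow> ('o, 'm, 'e) ext_bifunctor \<Rightarrow> 'o \<Rightarrow> 'o \<Rightarrow> 'o \<Rightarrow> 'm \<Rightarrow> 'e \<Rightarrow> 'e"
  where "pull \<C> E C A C' c \<delta> = ExtMap E C A C' A c (Ident \<C> A) \<delta>"

locale biadditive_functor = additive_category \<C>
  for \<C> :: "('o, 'm) add_cat" +
  fixes E :: "('o, 'm, 'e) ext_bifunctor"
  assumes Ext_comm_group: "\<lbrakk>C \<in> Obj \<C>; A \<in> Obj \<C>\<rbrakk> \<Longrightarrow> comm_group (Ext E C A)"
    and ExtMap_hom:
      "\<lbrakk>C \<in> Obj \<C>; A \<in> Obj \<C>; C' \<in> Obj \<C>; A' \<in> Obj \<C>; c \<in> Mor \<C> C' C; a \<in> Mor \<C> A A'\<rbrakk>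
        \<Longrightarrow> ExtMap E C A C' A' c a \<in> hom (Ext E C A) (Ext E C' A')"
    and ExtMap_Ident:
      "\<lbrakk>C \<in> Obj \<C>; A \<in> Obj \<C>; \<delta> \<in> carrier (Ext E C A)\<rbrakk>
        \<Longrightarrow> ExtMap E C A C A (Ident \<C> C) (Ident \<C> A) \<delta> = \<delta>"
    and ExtMap_Comp:
      "\<lbrakk>C \<in> Obj \<C>; A \<in> Obj \<C>; C' \<in> Obj \<C>; A' \<in> Obj \<C>; C'' \<in> Obj \<C>; A'' \<in> Obj \<C>;
        c \<in> Mor \<C> C' C; c' \<in> Mor \<C> C'' C'; a \<in> Mor \<C> A A'; a' \<in> Mor \<C> A' A'';
        \<delta> \<in> carrier (Ext E C A)\<rbrakk>
        \<Longrightarrow> ExtMap E C A C'' A'' (Comp \<C> C'' C' C c c') (Comp \<C> A A' A'' a' a) \<delta> =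
            ExtMap E C' A' C'' A'' c' a' (ExtMap E C A C' A' c a \<delta>)"
    and push_add:
      "\<lbrakk>C \<in> Obj \<C>; A \<in> Obj \<C>; A' \<in> Obj \<C>; a \<in> Mor \<C> A A'; b \<in> Mor \<C> A A';
        \<delta> \<in> carrier (Ext E C A)\<rbrakk>
        \<Longrightarrow> push \<C> E C A A' (a \<otimes>\<^bsub>Hom \<C> A A'\<^esub> b) \<delta> =
            push \<C> E C A A' a \<delta> \<otimes>\<^bsub>Ext E C A'\<^esub> push \<C> E C A A' b \<delta>"
    and pull_add:
      "\<lbrakk>C \<in> Obj \<C>; A \<in> Obj \<C>; C' \<in> Obj \<C>; c \<in> Mor \<C> C' C; d \<in> Mor \<C> C' C;
        \<delta> \<in> carrier (Ext E C A)\<rbrakk>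
        \<Longrightarrow> pull \<C> E C A C' (c \<otimes>\<^bsub>Hom \<C> C' C\<^esub> d) \<delta> =
            pull \<C> E C A C' c \<delta> \<otimes>\<^bsub>Ext E C' A\<^esub> pull \<C> E C A C' d \<delta>"

text \<open>The pair \<open>(a, c)\<close> is a morphism of extensions from \<open>\<delta> \<in> E(C, A)\<close> to \<open>\<delta>' \<in> E(C', A')\<close>.\<close>

definition ext_morphism ::
    "('o, 'm) add_cat \<Rightarrow> ('o, 'm, 'e) ext_bifunctor \<Rightarrow>
      'o \<Rightarrow> 'o \<Rightarrow> 'e \<Rightarrow> 'o \<Rightarrow> 'o \<Rightarrow> 'e \<Rightarrow> 'm \<Rightarrow> 'm \<Rightarrow> bool"
  where "ext_morphism \<C> E C A \<delta> C' A' \<delta>' a c \<longleftrightarrow>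
    a \<in> Mor \<C> A A' \<and> c \<in> Mor \<C> C C' \<and> push \<C> E C A A' a \<delta> = pull \<C> E C' A' C c \<delta>'"

text \<open>
  The decomposition of \<open>E(C \<oplus> C', A \<oplus> A')\<close> into the groups \<open>E(C, A)\<close>, \<open>E(C, A')\<close>, \<open>E(C', A)\<close> and
  \<open>E(C', A')\<close> identifies a quadruple with the sum of the images of its entries under the maps
  \<open>E(projection, inclusion)\<close>; \<open>\<delta> \<oplus> \<delta>'\<close> is the element given by \<open>(\<delta>, 0, 0, \<delta>')\<close>.
\<close>

definition ext_dsum ::
    "('o, 'm) add_cat \<Rightarrow> ('o, 'm, 'e) ext_bifunctor \<Rightarrow>
      'o \<Rightarrow> 'o \<Rightarrow> 'e \<Rightarrow> 'o \<Rightarrow> 'o \<Rightarrow> 'e \<Rightarrow> 'e"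
  where "ext_dsum \<C> E C A \<delta> C' A' \<delta>' =
    ExtMap E C A (Dsum \<C> C C') (Dsum \<C> A A') (Pr1 \<C> C C') (In1 \<C> A A') \<delta>
    \<otimes>\<^bsub>Ext E (Dsum \<C> C C') (Dsum \<C> A A')\<^esub>
    ExtMap E C' A' (Dsum \<C> C C') (Dsum \<C> A A') (Pr2 \<C> C C') (In2 \<C> A A') \<delta>'"

lemma (in biadditive_functor) ExtMap_closed:
  "\<lbrakk>C \<in> Obj \<C>; A \<in> Obj \<C>; C' \<in> Obj \<C>; A' \<in> Obj \<C>; c \<in> Mor \<C> C' C; a \<in> Mor \<C> A A';
    \<delta> \<in> carrier (Ext E C A)\<rbrakk> \<Longrightarrow> ExtMap E C A C' A' c a \<delta> \<in> carrier (Ext E C' A')"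
  using hom_in_carrier[OF ExtMap_hom] .

lemma (in biadditive_functor) ExtMap_zero:
  assumes [simp]: "C \<in> Obj \<C>" "A \<in> Obj \<C>" "C' \<in> Obj \<C>" "A' \<in> Obj \<C>"
    and \<delta>: "\<delta> \<in> carrier (Ext E C A)"
  shows "a \<in> Mor \<C> A A' \<Longrightarrow> ExtMap E C A C' A' \<one>\<^bsub>Hom \<C> C' C\<^esub> a \<delta> = \<one>\<^bsub>Ext E C' A'\<^esub>"
    and "c \<in> Mor \<C> C' C \<Longrightarrow> ExtMap E C A C' A' c \<one>\<^bsub>Hom \<C> A A'\<^esub> \<delta> = \<one>\<^bsub>Ext E C' A'\<^esub>"
proof -
  interpret hC: comm_group "Hom \<C> C' C" by (rule Hom_comm_group) simp_all
  interpret hA: comm_group "Hom \<C> A A'" by (rule Hom_comm_group) simp_all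
  interpret e1: comm_group "Ext E C' A" by (rule Ext_comm_group) simp_all
  interpret e2: comm_group "Ext E C A'" by (rule Ext_comm_group) simp_all
  interpret e3: comm_group "Ext E C' A'" by (rule Ext_comm_group) simp_all
  have cl: "ExtMap E C A C' A \<one>\<^bsub>Hom \<C> C' C\<^esub> (Ident \<C> A) \<delta> \<in> carrier (Ext E C' A)"
    using \<delta> by (simp add: ExtMap_closed Ident_closed)
  have pull0: "ExtMap E C A C' A \<one>\<^bsub>Hom \<C> C' C\<^esub> (Ident \<C> A) \<delta> = \<one>\<^bsub>Ext E C' A\<^esub>"
    using pull_add[of C A C' "\<one>\<^bsub>Hom \<C> C' C\<^esub>" "\<one>\<^bsub>Hom \<C> C' C\<^esub>" \<delta>] \<delta> cl
    by (simp add: pull_def)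
  have cl': "ExtMap E C A C A' (Ident \<C> C) \<one>\<^bsub>Hom \<C> A A'\<^esub> \<delta> \<in> carrier (Ext E C A')"
    using \<delta> by (simp add: ExtMap_closed Ident_closed)
  have push0: "ExtMap E C A C A' (Ident \<C> C) \<one>\<^bsub>Hom \<C> A A'\<^esub> \<delta> = \<one>\<^bsub>Ext E C A'\<^esub>"
    using push_add[of C A A' "\<one>\<^bsub>Hom \<C> A A'\<^esub>" "\<one>\<^bsub>Hom \<C> A A'\<^esub>" \<delta>] \<delta> cl'
    by (simp add: push_def)
  { assume a: "a \<in> Mor \<C> A A'"
    have "ExtMap E C A C' A' \<one>\<^bsub>Hom \<C> C' C\<^esub> a \<delta> =
        ExtMap E C' A C' A' (Ident \<C> C') a (ExtMap E C A C' A \<one>\<^bsub>Hom \<C> C' C\<^esub> (Ident \<C> A) \<delta>)"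
      using ExtMap_Comp[of C A C' A C' A' "\<one>\<^bsub>Hom \<C> C' C\<^esub>" "Ident \<C> C'" "Ident \<C> A" a \<delta>] a \<delta>
      by (simp add: Ident_closed Comp_Ident_right)
    also have "\<dots> = \<one>\<^bsub>Ext E C' A'\<^esub>"
      unfolding pull0 using ExtMap_hom[of C' A C' A' "Ident \<C> C'" a] a
      by (simp add: Ident_closed hom_one e1.is_group e3.is_group)
    finally show "ExtMap E C A C' A' \<one>\<^bsub>Hom \<C> C' C\<^esub> a \<delta> = \<one>\<^bsub>Ext E C' A'\<^esub>" . }
  { assume c: "c \<in> Mor \<C> C' C"
    have "ExtMap E C A C' A' c \<one>\<^bsub>Hom \<C> A A'\<^esub> \<delta> =
        ExtMap E C A' C' A' c (Ident \<C> A') (ExtMap E C A C A' (Ident \<C> C) \<one>\<^bsub>Hom \<C> A A'\<^esub> \<delta>)"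
      using ExtMap_Comp[of C A C A' C' A' "Ident \<C> C" c "\<one>\<^bsub>Hom \<C> A A'\<^esub>" "Ident \<C> A'" \<delta>] c \<delta>
      by (simp add: Ident_closed Comp_Ident_left)
    also have "\<dots> = \<one>\<^bsub>Ext E C' A'\<^esub>"
      unfolding push0 using ExtMap_hom[of C A' C' A' c "Ident \<C> A'"] c
      by (simp add: Ident_closed hom_one e2.is_group e3.is_group)
    finally show "ExtMap E C A C' A' c \<one>\<^bsub>Hom \<C> A A'\<^esub> \<delta> = \<one>\<^bsub>Ext E C' A'\<^esub>" . }
qed

lemma (in biadditive_functor) ExtMap_ext_dsum:
  assumes [simp]: "C \<in> Obj \<C>" "A \<in> Obj \<C>" "C' \<in> Obj \<C>" "A' \<in> Obj \<C>" "K \<in> Obj \<C>" "L \<in> Obj \<C>"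
    and "\<delta> \<in> carrier (Ext E C A)" "\<delta>' \<in> carrier (Ext E C' A')"
    and "c \<in> Mor \<C> K (Dsum \<C> C C')" "a \<in> Mor \<C> (Dsum \<C> A A') L"
  shows "ExtMap E (Dsum \<C> C C') (Dsum \<C> A A') K L c a (ext_dsum \<C> E C A \<delta> C' A' \<delta>') =
    ExtMap E C A K L (Comp \<C> K (Dsum \<C> C C') C (Pr1 \<C> C C') c)
      (Comp \<C> A (Dsum \<C> A A') L a (In1 \<C> A A')) \<delta>
    \<otimes>\<^bsub>Ext E K L\<^esub>
    ExtMap E C' A' K L (Comp \<C> K (Dsum \<C> C C') C' (Pr2 \<C> C C') c)
      (Comp \<C> A' (Dsum \<C> A A') L a (In2 \<C> A A')) \<delta>'"
proof -
  let ?P = "Dsum \<C> C C'" and ?Q = "Dsum \<C> A A'"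
  have [simp]: "?P \<in> Obj \<C>" "?Q \<in> Obj \<C>" by (simp_all add: Dsum_closed)
  have "ExtMap E C A ?P ?Q (Pr1 \<C> C C') (In1 \<C> A A') \<delta> \<in> carrier (Ext E ?P ?Q)"
    "ExtMap E C' A' ?P ?Q (Pr2 \<C> C C') (In2 \<C> A A') \<delta>' \<in> carrier (Ext E ?P ?Q)"
    using assms by (simp_all add: ExtMap_closed In1_closed In2_closed Pr1_closed Pr2_closed)
  then show ?thesis
    unfolding ext_dsum_def
    using ExtMap_hom[of ?P ?Q K L c a] assms
    by (simp add: hom_mult ExtMap_Comp In1_closed In2_closed Pr1_closed Pr2_closed)
qed

lemma (in biadditive_functor) ext_dsum_components:
  assumes [simp]: "C \<in> Obj \<C>" "A \<in> Obj \<C>" "\<delta> \<in> carrier (Ext E C A)"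
    and [simp]: "C' \<in> Obj \<C>" "A' \<in> Obj \<C>" "\<delta>' \<in> carrier (Ext E C' A')"
  defines "\<epsilon> \<equiv> ext_dsum \<C> E C A \<delta> C' A' \<delta>'"
  shows "ExtMap E (Dsum \<C> C C') (Dsum \<C> A A') C A (In1 \<C> C C') (Pr1 \<C> A A') \<epsilon> = \<delta>"
    and "ExtMap E (Dsum \<C> C C') (Dsum \<C> A A') C A' (In1 \<C> C C') (Pr2 \<C> A A') \<epsilon>
      = \<one>\<^bsub>Ext E C A'\<^esub>"
    and "ExtMap E (Dsum \<C> C C') (Dsum \<C> A A') C' A (In2 \<C> C C') (Pr1 \<C> A A') \<epsilon>
      = \<one>\<^bsub>Ext E C' A\<^esub>"
    and "ExtMap E (Dsum \<C> C C') (Dsum \<C> A A') C' A' (In2 \<C> C C') (Pr2 \<C> A A') \<epsilon> = \<delta>'"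
proof -
  have g: "group (Ext E X Y)" "group (Hom \<C> X Y)" if "X \<in> Obj \<C>" "Y \<in> Obj \<C>" for X Y
    using that Ext_comm_group Hom_comm_group by (simp_all add: comm_group_def)
  have m: "monoid (Ext E X Y)" "monoid (Hom \<C> X Y)" if "X \<in> Obj \<C>" "Y \<in> Obj \<C>" for X Y
    using g[OF that] by (simp_all add: group.is_monoid)
  note [simp] = ExtMap_ext_dsum In1_closed In2_closed Pr1_closed Pr2_closed
    Pr1_In1 Pr2_In2 Pr1_In2 Pr2_In1 ExtMap_zero ExtMap_Ident Ident_closed
    m monoid.one_closed monoid.l_one monoid.r_one
  show "ExtMap E (Dsum \<C> C C') (Dsum \<C> A A') C A (In1 \<C> C C') (Pr1 \<C> A A') \<epsilon> = \<delta>"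
    and "ExtMap E (Dsum \<C> C C') (Dsum \<C> A A') C A' (In1 \<C> C C') (Pr2 \<C> A A') \<epsilon>
      = \<one>\<^bsub>Ext E C A'\<^esub>"
    and "ExtMap E (Dsum \<C> C C') (Dsum \<C> A A') C' A (In2 \<C> C C') (Pr1 \<C> A A') \<epsilon>
      = \<one>\<^bsub>Ext E C' A\<^esub>"
    and "ExtMap E (Dsum \<C> C C') (Dsum \<C> A A') C' A' (In2 \<C> C C') (Pr2 \<C> A A') \<epsilon> = \<delta>'"
    by (simp_all add: \<epsilon>_def)
qed


section \<open>Realisations\<close>

text \<open>A sequence \<open>x : A \<rightarrow> B\<close>, \<open>y : B \<rightarrow> C\<close> with fixed ends is the triple \<open>(B, x, y)\<close>.\<close>

definition sequences :: "('o, 'm) add_cat \<Rightarrow> 'o \<Rightarrow> 'o \<Rightarrow> ('o \<times> 'm \<times> 'm) set"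
  where "sequences \<C> A C = {(B, x, y). B \<in> Obj \<C> \<and> x \<in> Mor \<C> A B \<and> y \<in> Mor \<C> B C}"

definition seq_equiv :: "('o, 'm) add_cat \<Rightarrow> 'o \<Rightarrow> 'o \<Rightarrow> ('o \<times> 'm \<times> 'm) rel"
  where "seq_equiv \<C> A C =
    {((B, x, y), (B', x', y')). (B, x, y) \<in> sequences \<C> A C \<and> (B', x', y') \<in> sequences \<C> A C \<and>
      (\<exists>b. is_iso \<C> B B' b \<and> Comp \<C> A B B' b x = x' \<and> Comp \<C> B B' C y' b = y)}"

definition seq_class ::
    "('o, 'm) add_cat \<Rightarrow> 'o \<Rightarrow> 'o \<Rightarrow> 'o \<Rightarrow> 'm \<Rightarrow> 'm \<Rightarrow> ('o \<times> 'm \<times> 'm) set"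
  where "seq_class \<C> A B C x y = seq_equiv \<C> A C `` {(B, x, y)}"

text \<open>
  A correspondence \<open>s\<close> sends \<open>\<delta> \<in> E(C, A)\<close> to the class \<open>s C A \<delta>\<close>. The predicate says that \<open>\<delta>\<close> is
  an element of \<open>E(C, A)\<close> with \<open>s(\<delta>)\<close> the class of \<open>A \<rightarrow> B \<rightarrow> C\<close>.
\<close>

type_synonym ('o, 'm, 'e) correspondence = "'o \<Rightarrow> 'o \<Rightarrow> 'e \<Rightarrow> ('o \<times> 'm \<times> 'm) set"

definition realised_by ::
    "('o, 'm) add_cat \<Rightarrow> ('o, 'm, 'e) ext_bifunctor \<Rightarrow> ('o, 'm, 'e) correspondence \<Rightarrow>
      'e \<Rightarrow> 'o \<Rightarrow> 'o \<Rightarrow> 'o \<Rightarrow> 'm \<Rightarrow> 'm \<Rightarrow> bool"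
  where "realised_by \<C> E s \<delta> A B C x y \<longleftrightarrow>
    A \<in> Obj \<C> \<and> C \<in> Obj \<C> \<and> \<delta> \<in> carrier (Ext E C A) \<and> (B, x, y) \<in> sequences \<C> A C \<and>
    s C A \<delta> = seq_class \<C> A B C x y"

locale realisation = biadditive_functor \<C> E
  for \<C> :: "('o, 'm) add_cat" and E :: "('o, 'm, 'e) ext_bifunctor" +
  fixes s :: "('o, 'm, 'e) correspondence"
  assumes class_of_sequences:
      "\<lbrakk>C \<in> Obj \<C>; A \<in> Obj \<C>; \<delta> \<in> carrier (Ext E C A)\<rbrakk>
        \<Longrightarrow> s C A \<delta> \<in> sequences \<C> A C // seq_equiv \<C> A C"
    and realise_morphism:
      "\<lbrakk>realised_by \<C> E s \<delta> A B C x y; realised_by \<C> E s \<delta>' A' B' C' x' y';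
        ext_morphism \<C> E C A \<delta> C' A' \<delta>' a c\<rbrakk>
        \<Longrightarrow> \<exists>b\<in>Mor \<C> B B'. Comp \<C> A B B' b x = Comp \<C> A A' B' x' a \<and>
              Comp \<C> B B' C' y' b = Comp \<C> B C C' c y"

locale additive_realisation = realisation \<C> E s
  for \<C> :: "('o, 'm) add_cat" and E :: "('o, 'm, 'e) ext_bifunctor"
    and s :: "('o, 'm, 'e) correspondence" +
  assumes realise_zero:
      "\<lbrakk>C \<in> Obj \<C>; A \<in> Obj \<C>\<rbrakk>
        \<Longrightarrow> s C A \<one>\<^bsub>Ext E C A\<^esub> = seq_class \<C> A (Dsum \<C> A C) C (In1 \<C> A C) (Pr2 \<C> A C)"
    and realise_dsum:
      "\<lbrakk>realised_by \<C> E s \<delta> A B C x y; realised_by \<C> E s \<delta>' A' B' C' x' y'\<rbrakk>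
        \<Longrightarrow> s (Dsum \<C> C C') (Dsum \<C> A A') (ext_dsum \<C> E C A \<delta> C' A' \<delta>') =
            seq_class \<C> (Dsum \<C> A A') (Dsum \<C> B B') (Dsum \<C> C C')
              (dsum_mor \<C> A B A' B' x x') (dsum_mor \<C> B C B' C' y y')"


section \<open>Extriangulated categories\<close>

locale extriangulated_category = additive_realisation \<C> E s
  for \<C> :: "('o, 'm) add_cat" and E :: "('o, 'm, 'e) ext_bifunctor"
    and s :: "('o, 'm, 'e) correspondence" +
  assumes ET3:
      "\<lbrakk>realised_by \<C> E s \<delta> A B C x y; realised_by \<C> E s \<delta>' A' B' C' x' y';
        a \<in> Mor \<C> A A'; b \<in> Mor \<C> B B'; Comp \<C> A B B' b x = Comp \<C> A A' B' x' a\<rbrakk>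
        \<Longrightarrow> \<exists>c\<in>Mor \<C> C C'. ext_morphism \<C> E C A \<delta> C' A' \<delta>' a c \<and>
              Comp \<C> B B' C' y' b = Comp \<C> B C C' c y"
    and ET3_op:
      "\<lbrakk>realised_by \<C> E s \<delta> A B C x y; realised_by \<C> E s \<delta>' A' B' C' x' y';
        b \<in> Mor \<C> B B'; c \<in> Mor \<C> C C'; Comp \<C> B C C' c y = Comp \<C> B B' C' y' b\<rbrakk>
        \<Longrightarrow> \<exists>a\<in>Mor \<C> A A'. ext_morphism \<C> E C A \<delta> C' A' \<delta>' a c \<and>
              Comp \<C> A B B' b x = Comp \<C> A A' B' x' a"
    and ET4:
      "\<lbrakk>realised_by \<C> E s \<delta> A B D f f'; realised_by \<C> E s \<delta>' B C F g g'\<rbrakk>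
        \<Longrightarrow> \<exists>G\<in>Obj \<C>. \<exists>h\<in>Mor \<C> A C. \<exists>h'\<in>Mor \<C> C G. \<exists>d\<in>Mor \<C> D G. \<exists>e\<in>Mor \<C> G F.
              h = Comp \<C> A B C g f \<and>
              Comp \<C> B C G h' g = Comp \<C> B D G d f' \<and>
              Comp \<C> C G F e h' = g' \<and>
              (\<exists>\<delta>''\<in>carrier (Ext E G A).
                realised_by \<C> E s \<delta>'' A C G h h' \<and>
                realised_by \<C> E s (push \<C> E F B D f' \<delta>') D G F d e \<and>
                pull \<C> E G A D d \<delta>'' = \<delta> \<and>
                push \<C> E G A B f \<delta>'' = pull \<C> E F B G e \<delta>')"
    and ET4_op:
      "\<lbrakk>realised_by \<C> E s \<delta> D A B f' f; realised_by \<C> E s \<delta>' F B C g' g\<rbrakk>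
        \<Longrightarrow> \<exists>G\<in>Obj \<C>. \<exists>d\<in>Mor \<C> D G. \<exists>e\<in>Mor \<C> G F. \<exists>h'\<in>Mor \<C> G A. \<exists>h\<in>Mor \<C> A C.
              h = Comp \<C> A B C g f \<and>
              Comp \<C> D G A h' d = f' \<and>
              Comp \<C> G A B f h' = Comp \<C> G F B g' e \<and>
              (\<exists>\<delta>''\<in>carrier (Ext E C G).
                realised_by \<C> E s \<delta>'' G A C h' h \<and>
                realised_by \<C> E s (pull \<C> E B D F g' \<delta>) D G F d e \<and>
                push \<C> E C G F e \<delta>'' = \<delta>' \<and>
                push \<C> E B D G d \<delta> = pull \<C> E C G B g \<delta>'')"


section \<open>Extriangulated functors\<close>

locale additive_functor = src: additive_category \<C> + tgt: additive_category \<D>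
  for \<C> :: "('o, 'm) add_cat" and \<D> :: "('p, 'n) add_cat" +
  fixes Fo :: "'o \<Rightarrow> 'p" and Fm :: "'o \<Rightarrow> 'o \<Rightarrow> 'm \<Rightarrow> 'n"
  assumes Fo_closed: "A \<in> Obj \<C> \<Longrightarrow> Fo A \<in> Obj \<D>"
    and Fm_hom:
      "\<lbrakk>A \<in> Obj \<C>; B \<in> Obj \<C>\<rbrakk> \<Longrightarrow> Fm A B \<in> hom (Hom \<C> A B) (Hom \<D> (Fo A) (Fo B))"
    and Fm_Ident: "A \<in> Obj \<C> \<Longrightarrow> Fm A A (Ident \<C> A) = Ident \<D> (Fo A)"
    and Fm_Comp:
      "\<lbrakk>A \<in> Obj \<C>; B \<in> Obj \<C>; D \<in> Obj \<C>; f \<in> Mor \<C> A B; g \<in> Mor \<C> B D\<rbrakk>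
        \<Longrightarrow> Fm A D (Comp \<C> A B D g f) = Comp \<D> (Fo A) (Fo B) (Fo D) (Fm B D g) (Fm A B f)"

definition ext_nat_trans ::
    "('o, 'm) add_cat \<Rightarrow> ('o, 'm, 'e) ext_bifunctor \<Rightarrow> ('p, 'n, 'd) ext_bifunctor \<Rightarrow>
      ('o \<Rightarrow> 'p) \<Rightarrow> ('o \<Rightarrow> 'o \<Rightarrow> 'm \<Rightarrow> 'n) \<Rightarrow> ('o \<Rightarrow> 'o \<Rightarrow> 'e \<Rightarrow> 'd) \<Rightarrow> bool"
  where "ext_nat_trans \<C> E E' Fo Fm \<Gamma> \<longleftrightarrow>
    (\<forall>Z\<in>Obj \<C>. \<forall>X\<in>Obj \<C>. \<Gamma> Z X \<in> hom (Ext E Z X) (Ext E' (Fo Z) (Fo X))) \<and>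
    (\<forall>Z\<in>Obj \<C>. \<forall>X\<in>Obj \<C>. \<forall>Z'\<in>Obj \<C>. \<forall>X'\<in>Obj \<C>.
      \<forall>z\<in>Mor \<C> Z' Z. \<forall>x\<in>Mor \<C> X X'. \<forall>\<delta>\<in>carrier (Ext E Z X).
        \<Gamma> Z' X' (ExtMap E Z X Z' X' z x \<delta>) =
        ExtMap E' (Fo Z) (Fo X) (Fo Z') (Fo X') (Fm Z' Z z) (Fm X X' x) (\<Gamma> Z X \<delta>))"

locale extriangulated_functor =
  src: extriangulated_category \<C> E s + tgt: extriangulated_category \<D> E' s' +
  additive_functor \<C> \<D> Fo Fm
  for \<C> :: "('o, 'm) add_cat" and E :: "('o, 'm, 'e) ext_bifunctor"
    and s :: "('o, 'm, 'e) correspondence"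
    and \<D> :: "('p, 'n) add_cat" and E' :: "('p, 'n, 'd) ext_bifunctor"
    and s' :: "('p, 'n, 'd) correspondence"
    and Fo :: "'o \<Rightarrow> 'p" and Fm :: "'o \<Rightarrow> 'o \<Rightarrow> 'm \<Rightarrow> 'n" +
  assumes ex_nat_trans:
    "\<exists>\<Gamma>. ext_nat_trans \<C> E E' Fo Fm \<Gamma> \<and>
      (\<forall>\<delta> X Y Z x y. realised_by \<C> E s \<delta> X Y Z x y \<longrightarrow>
        realised_by \<D> E' s' (\<Gamma> Z X \<delta>) (Fo X) (Fo Y) (Fo Z) (Fm X Y x) (Fm Y Z y))"

definition wic_embed_obj :: "('o, 'm) add_cat \<Rightarrow> 'o \<Rightarrow> 'o \<times> 'm"
  where "wic_embed_obj \<C> A = (A, Ident \<C> A)"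

definition wic_embed_mor :: "'o \<Rightarrow> 'o \<Rightarrow> 'm \<Rightarrow> 'm"
  where "wic_embed_mor A B f = f"

end

(* Only idempotents that split in \<C> occur in the completion, so (A, p) with p = c r and r c = 1
   is isomorphic to the image X of p, and (A, p) |-> X, f |-> r f c is an equivalence from the
   completion to \<C>, strictly inverse to the embedding on one side. An extriangulated structure
   pulls back along such a functor Q: put E'(C, A) = E(Q C, Q A) and call a sequence a realisation
   if its image is one. The axioms transfer directly, except that Q preserves direct sums only up
   to isomorphism; this requires that realisations can be transported along isomorphisms of
   extensions, which follows from (ET3). *)

theory Submission
  imports Defs
begin

section \<open>Additive categories\<close>

text \<open>The definition of a realisation lifts a morphism of extensions to some map of middle
  terms, with no uniqueness and no functoriality. Lifting an isomorphism and its inverse therefore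
  gives \<open>b\<close> and \<open>b'\<close> whose composites are known to be identities only at
  the two ends; that such endomorphisms are invertible is the point where (ET3) enters. Direct sums
  are affected because \<open>Q\<close> of a sum uses a splitting of p (+) q that is chosen
  independently of those chosen for p and q. The group E'((C, p), (A, q)) is in essence the summand
  of E(C, A) cut out by the idempotent E(p, q): the retractions and sections identify that summand
  with E(Q C, Q A). In the latter form the bifunctor axioms are instances of those of
  \<open>E\<close>. The strict one-sided inverse serves twice. Every object of \<open>\<C>\<close>
  is literally some Q A, so the objects that the axioms produce lift without correction; and
  extensions between embedded objects are the original ones, so the transformation for the embedding
  can be the identity.\<close>

context additive_category
begin

section \<open>Zero morphisms and negatives under composition\<close>

lemma Hom_group: "\<lbrakk>A \<in> Obj \<C>; B \<in> Obj \<C>\<rbrakk> \<Longrightarrow> group (Hom \<C> A B)"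
  using Hom_comm_group by (simp add: comm_group_def)

lemma Hom_monoid: "\<lbrakk>A \<in> Obj \<C>; B \<in> Obj \<C>\<rbrakk> \<Longrightarrow> monoid (Hom \<C> A B)"
  using Hom_group by (simp add: group.is_monoid)

lemma Hom_zero_closed: "\<lbrakk>A \<in> Obj \<C>; B \<in> Obj \<C>\<rbrakk> \<Longrightarrow> \<one>\<^bsub>Hom \<C> A B\<^esub> \<in> Mor \<C> A B"
  by (simp add: Hom_monoid monoid.one_closed)

lemma Hom_add_closed:
  "\<lbrakk>A \<in> Obj \<C>; B \<in> Obj \<C>; f \<in> Mor \<C> A B; g \<in> Mor \<C> A B\<rbrakk>
    \<Longrightarrow> f \<otimes>\<^bsub>Hom \<C> A B\<^esub> g \<in> Mor \<C> A B"
  by (simp add: Hom_monoid monoid.m_closed)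

lemma Hom_add_zero:
  "\<lbrakk>A \<in> Obj \<C>; B \<in> Obj \<C>; f \<in> Mor \<C> A B\<rbrakk> \<Longrightarrow> \<one>\<^bsub>Hom \<C> A B\<^esub> \<otimes>\<^bsub>Hom \<C> A B\<^esub> f = f"
  "\<lbrakk>A \<in> Obj \<C>; B \<in> Obj \<C>; f \<in> Mor \<C> A B\<rbrakk> \<Longrightarrow> f \<otimes>\<^bsub>Hom \<C> A B\<^esub> \<one>\<^bsub>Hom \<C> A B\<^esub> = f"
  by (simp_all add: Hom_monoid monoid.l_one monoid.r_one)

text \<open>g 0 = g (0 + 0) = g 0 + g 0, and the only idempotent element of a group is its
  unit.\<close>

lemma Comp_zero_right:
  assumes [simp]: "A \<in> Obj \<C>" "B \<in> Obj \<C>" "D \<in> Obj \<C>" "g \<in> Mor \<C> B D"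
  shows "Comp \<C> A B D g \<one>\<^bsub>Hom \<C> A B\<^esub> = \<one>\<^bsub>Hom \<C> A D\<^esub>"
proof -
  interpret group "Hom \<C> A D" by (simp add: Hom_group)
  have "Comp \<C> A B D g \<one>\<^bsub>Hom \<C> A B\<^esub> \<in> Mor \<C> A D"
    by (simp add: Comp_closed Hom_zero_closed)
  then show ?thesis
    using Comp_add_right[of A B D "\<one>\<^bsub>Hom \<C> A B\<^esub>" "\<one>\<^bsub>Hom \<C> A B\<^esub>" g]
    by (simp add: Hom_zero_closed Hom_add_zero)
qed

lemma Comp_zero_left:
  assumes [simp]: "A \<in> Obj \<C>" "B \<in> Obj \<C>" "D \<in> Obj \<C>" "f \<in> Mor \<C> A B"
  shows "Comp \<C> A B D \<one>\<^bsub>Hom \<C> B D\<^esub> f = \<one>\<^bsub>Hom \<C> A D\<^esub>"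
proof -
  interpret group "Hom \<C> A D" by (simp add: Hom_group)
  have "Comp \<C> A B D \<one>\<^bsub>Hom \<C> B D\<^esub> f \<in> Mor \<C> A D"
    by (simp add: Comp_closed Hom_zero_closed)
  then show ?thesis
    using Comp_add_left[of A B D f "\<one>\<^bsub>Hom \<C> B D\<^esub>" "\<one>\<^bsub>Hom \<C> B D\<^esub>"]
    by (simp add: Hom_zero_closed Hom_add_zero)
qed

text \<open>Additivity carries the equation -f + f = 0 to the equation that characterises the
  negative of g f. This and its mirror image show that the morphisms of the completion are closed
  under negatives.\<close>

lemma Comp_inv_right:
  assumes [simp]: "A \<in> Obj \<C>" "B \<in> Obj \<C>" "D \<in> Obj \<C>" "f \<in> Mor \<C> A B" "g \<in> Mor \<C> B D"
  shows "Comp \<C> A B D g (inv\<^bsub>Hom \<C> A B\<^esub> f) = inv\<^bsub>Hom \<C> A D\<^esub> (Comp \<C> A B D g f)"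
proof -
  interpret AB: group "Hom \<C> A B" by (simp add: Hom_group)
  interpret AD: group "Hom \<C> A D" by (simp add: Hom_group)
  show ?thesis
    by (rule AD.inv_equality[symmetric]) (simp_all add: Comp_closed Comp_zero_right flip: Comp_add_right)
qed

lemma Comp_inv_left:
  assumes [simp]: "A \<in> Obj \<C>" "B \<in> Obj \<C>" "D \<in> Obj \<C>" "f \<in> Mor \<C> A B" "g \<in> Mor \<C> B D"
  shows "Comp \<C> A B D (inv\<^bsub>Hom \<C> B D\<^esub> g) f = inv\<^bsub>Hom \<C> A D\<^esub> (Comp \<C> A B D g f)"
proof -
  interpret BD: group "Hom \<C> B D" by (simp add: Hom_group)
  interpret AD: group "Hom \<C> A D" by (simp add: Hom_group)
  show ?thesis
    by (rule AD.inv_equality[symmetric]) (simp_all add: Comp_closed Comp_zero_left flip: Comp_add_left)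
qed

lemmas cat_simps = Ident_closed Comp_closed Comp_Ident_right Comp_Ident_left
  Hom_zero_closed Hom_add_closed Hom_add_zero Comp_zero_right Comp_zero_left
  Comp_add_right Comp_add_left Dsum_closed In1_closed In2_closed Pr1_closed Pr2_closed
  Pr1_In1 Pr2_In2 Pr1_In2 Pr2_In1

text \<open>Once \<open>Comp_assoc\<close> has nested a composite to the right, a projection meets
  an inclusion that already carries a further factor; these are the biproduct identities in that
  shape.\<close>

lemma proj_incl_cancel:
  assumes [simp]: "A \<in> Obj \<C>" "B \<in> Obj \<C>" "K \<in> Obj \<C>"
  shows "f \<in> Mor \<C> K A \<Longrightarrow>
      Comp \<C> K (Dsum \<C> A B) A (Pr1 \<C> A B) (Comp \<C> K A (Dsum \<C> A B) (In1 \<C> A B) f) = f"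
    and "f \<in> Mor \<C> K A \<Longrightarrow>
      Comp \<C> K (Dsum \<C> A B) B (Pr2 \<C> A B) (Comp \<C> K A (Dsum \<C> A B) (In1 \<C> A B) f)
        = \<one>\<^bsub>Hom \<C> K B\<^esub>"
    and "g \<in> Mor \<C> K B \<Longrightarrow>
      Comp \<C> K (Dsum \<C> A B) A (Pr1 \<C> A B) (Comp \<C> K B (Dsum \<C> A B) (In2 \<C> A B) g)
        = \<one>\<^bsub>Hom \<C> K A\<^esub>"
    and "g \<in> Mor \<C> K B \<Longrightarrow>
      Comp \<C> K (Dsum \<C> A B) B (Pr2 \<C> A B) (Comp \<C> K B (Dsum \<C> A B) (In2 \<C> A B) g) = g"
  by (simp_all add: cat_simps flip: Comp_assoc)

section \<open>Direct sums of morphisms and maps out of a direct sum\<close>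

lemma dsum_mor_closed:
  "\<lbrakk>A \<in> Obj \<C>; B \<in> Obj \<C>; A' \<in> Obj \<C>; B' \<in> Obj \<C>; f \<in> Mor \<C> A B; f' \<in> Mor \<C> A' B'\<rbrakk>
    \<Longrightarrow> dsum_mor \<C> A B A' B' f f' \<in> Mor \<C> (Dsum \<C> A A') (Dsum \<C> B B')"
  by (simp add: dsum_mor_def cat_simps)

lemma dsum_mor_In:
  assumes [simp]: "A \<in> Obj \<C>" "B \<in> Obj \<C>" "A' \<in> Obj \<C>" "B' \<in> Obj \<C>"
    "f \<in> Mor \<C> A B" "f' \<in> Mor \<C> A' B'"
  shows "Comp \<C> A (Dsum \<C> A A') (Dsum \<C> B B') (dsum_mor \<C> A B A' B' f f') (In1 \<C> A A')
      = Comp \<C> A B (Dsum \<C> B B') (In1 \<C> B B') f"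
    and "Comp \<C> A' (Dsum \<C> A A') (Dsum \<C> B B') (dsum_mor \<C> A B A' B' f f') (In2 \<C> A A')
      = Comp \<C> A' B' (Dsum \<C> B B') (In2 \<C> B B') f'"
  by (simp_all add: dsum_mor_def cat_simps Comp_assoc)

text \<open>Composing \<open>h\<close> with the identity written as in1 pr1 + in2 pr2 recovers
  \<open>h\<close> from its restrictions to the two summands. This is the uniqueness half of the
  universal property of the coproduct.\<close>

lemma eq_on_Dsum:
  assumes [simp]: "A \<in> Obj \<C>" "B \<in> Obj \<C>" "K \<in> Obj \<C>"
    and fg [simp]: "f \<in> Mor \<C> (Dsum \<C> A B) K" "g \<in> Mor \<C> (Dsum \<C> A B) K"
    and eq: "Comp \<C> A (Dsum \<C> A B) K f (In1 \<C> A B) = Comp \<C> A (Dsum \<C> A B) K g (In1 \<C> A B)"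
      "Comp \<C> B (Dsum \<C> A B) K f (In2 \<C> A B) = Comp \<C> B (Dsum \<C> A B) K g (In2 \<C> A B)"
  shows "f = g"
proof -
  let ?P = "Dsum \<C> A B"
  have split: "h = Comp \<C> ?P A K (Comp \<C> A ?P K h (In1 \<C> A B)) (Pr1 \<C> A B)
      \<otimes>\<^bsub>Hom \<C> ?P K\<^esub> Comp \<C> ?P B K (Comp \<C> B ?P K h (In2 \<C> A B)) (Pr2 \<C> A B)"
    if [simp]: "h \<in> Mor \<C> ?P K" for h
  proof -
    have "h = Comp \<C> ?P ?P K h (Comp \<C> ?P A ?P (In1 \<C> A B) (Pr1 \<C> A B)
        \<otimes>\<^bsub>Hom \<C> ?P ?P\<^esub> Comp \<C> ?P B ?P (In2 \<C> A B) (Pr2 \<C> A B))"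
      by (simp add: In_Pr_sum cat_simps)
    then show ?thesis by (simp add: cat_simps Comp_assoc)
  qed
  show ?thesis by (subst (1 2) split) (simp_all add: eq)
qed

text \<open>Both sides are compared on the inclusions, where \<open>dsum_mor_In\<close> replaces a
  sum of maps by its components. This functoriality makes a sum of splittings a splitting.\<close>

lemma dsum_mor_comp:
  assumes [simp]: "A \<in> Obj \<C>" "B \<in> Obj \<C>" "D \<in> Obj \<C>" "A' \<in> Obj \<C>" "B' \<in> Obj \<C>" "D' \<in> Obj \<C>"
    "f \<in> Mor \<C> A B" "f' \<in> Mor \<C> A' B'" "g \<in> Mor \<C> B D" "g' \<in> Mor \<C> B' D'"
  shows "Comp \<C> (Dsum \<C> A A') (Dsum \<C> B B') (Dsum \<C> D D')
      (dsum_mor \<C> B D B' D' g g') (dsum_mor \<C> A B A' B' f f')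
    = dsum_mor \<C> A D A' D' (Comp \<C> A B D g f) (Comp \<C> A' B' D' g' f')"
proof (rule eq_on_Dsum[of A A' "Dsum \<C> D D'"])
  have "Comp \<C> A (Dsum \<C> B B') (Dsum \<C> D D') (dsum_mor \<C> B D B' D' g g')
      (Comp \<C> A B (Dsum \<C> B B') (In1 \<C> B B') f) =
      Comp \<C> A B (Dsum \<C> D D') (Comp \<C> B D (Dsum \<C> D D') (In1 \<C> D D') g) f"
    by (subst Comp_assoc[symmetric]) (simp_all add: cat_simps dsum_mor_closed dsum_mor_In)
  then show "Comp \<C> A (Dsum \<C> A A') (Dsum \<C> D D') (Comp \<C> (Dsum \<C> A A') (Dsum \<C> B B')
      (Dsum \<C> D D') (dsum_mor \<C> B D B' D' g g') (dsum_mor \<C> A B A' B' f f')) (In1 \<C> A A') =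
    Comp \<C> A (Dsum \<C> A A') (Dsum \<C> D D')
      (dsum_mor \<C> A D A' D' (Comp \<C> A B D g f) (Comp \<C> A' B' D' g' f')) (In1 \<C> A A')"
    by (simp add: cat_simps dsum_mor_closed dsum_mor_In Comp_assoc)
  have "Comp \<C> A' (Dsum \<C> B B') (Dsum \<C> D D') (dsum_mor \<C> B D B' D' g g')
      (Comp \<C> A' B' (Dsum \<C> B B') (In2 \<C> B B') f') =
      Comp \<C> A' B' (Dsum \<C> D D') (Comp \<C> B' D' (Dsum \<C> D D') (In2 \<C> D D') g') f'"
    by (subst Comp_assoc[symmetric]) (simp_all add: cat_simps dsum_mor_closed dsum_mor_In)
  then show "Comp \<C> A' (Dsum \<C> A A') (Dsum \<C> D D') (Comp \<C> (Dsum \<C> A A') (Dsum \<C> B B')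
      (Dsum \<C> D D') (dsum_mor \<C> B D B' D' g g') (dsum_mor \<C> A B A' B' f f')) (In2 \<C> A A') =
    Comp \<C> A' (Dsum \<C> A A') (Dsum \<C> D D')
      (dsum_mor \<C> A D A' D' (Comp \<C> A B D g f) (Comp \<C> A' B' D' g' f')) (In2 \<C> A A')"
    by (simp add: cat_simps dsum_mor_closed dsum_mor_In Comp_assoc)
qed (simp_all add: cat_simps dsum_mor_closed)

lemma dsum_mor_Ident:
  assumes [simp]: "A \<in> Obj \<C>" "B \<in> Obj \<C>"
  shows "dsum_mor \<C> A A B B (Ident \<C> A) (Ident \<C> B) = Ident \<C> (Dsum \<C> A B)"
  by (rule eq_on_Dsum[of A B "Dsum \<C> A B"]) (simp_all add: cat_simps dsum_mor_closed dsum_mor_In)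

text \<open>g = g (f h) = (g f) h = h. The two inverses are kept apart because, for a map between
  middle terms, they come from endomorphisms of two different objects.\<close>

lemma is_iso_of_one_sided_inverses:
  assumes [simp]: "A \<in> Obj \<C>" "B \<in> Obj \<C>" "f \<in> Mor \<C> A B" "g \<in> Mor \<C> B A" "h \<in> Mor \<C> B A"
    and gf: "Comp \<C> A B A g f = Ident \<C> A" and fh: "Comp \<C> B A B f h = Ident \<C> B"
  shows "is_iso \<C> A B f"
proof -
  have "g = Comp \<C> B B A g (Comp \<C> B A B f h)" by (simp add: fh cat_simps)
  also have "\<dots> = h" by (simp add: gf cat_simps flip: Comp_assoc)
  finally show ?thesis unfolding is_iso_def using gf fh by auto
qed

lemma is_iso_Ident: "A \<in> Obj \<C> \<Longrightarrow> is_iso \<C> A A (Ident \<C> A)"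
  by (auto simp: is_iso_def cat_simps)

lemma is_iso_Comp:
  assumes [simp]: "A \<in> Obj \<C>" "B \<in> Obj \<C>" "D \<in> Obj \<C>"
    and "is_iso \<C> A B f" "is_iso \<C> B D g"
  shows "is_iso \<C> A D (Comp \<C> A B D g f)"
proof -
  obtain f' where f: "f \<in> Mor \<C> A B" "f' \<in> Mor \<C> B A"
    "Comp \<C> A B A f' f = Ident \<C> A" "Comp \<C> B A B f f' = Ident \<C> B"
    using assms(4) by (auto simp: is_iso_def)
  obtain g' where g: "g \<in> Mor \<C> B D" "g' \<in> Mor \<C> D B"
    "Comp \<C> B D B g' g = Ident \<C> B" "Comp \<C> D B D g g' = Ident \<C> D"
    using assms(5) by (auto simp: is_iso_def)
  have "Comp \<C> A D B g' (Comp \<C> A B D g f) = f" "Comp \<C> D A B f (Comp \<C> D B A f' g') = g'"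
    by (simp_all add: f g cat_simps flip: Comp_assoc)
  then show ?thesis
    using f g by (intro is_iso_of_one_sided_inverses[of A D _ "Comp \<C> D B A f' g'" "Comp \<C> D B A f' g'"])
      (simp_all add: cat_simps Comp_assoc)
qed

text \<open>With this, \<open>seq_class\<close> yields genuine classes of a partition, and equality
  of classes can be exchanged for membership.\<close>

lemma equiv_seq_equiv:
  assumes [simp]: "A \<in> Obj \<C>" "C \<in> Obj \<C>"
  shows "equiv (sequences \<C> A C) (seq_equiv \<C> A C)"
proof (rule equivI)
  show "seq_equiv \<C> A C \<subseteq> sequences \<C> A C \<times> sequences \<C> A C"
    by (auto simp: seq_equiv_def)
  show "refl_on (sequences \<C> A C) (seq_equiv \<C> A C)"
  proof (rule refl_onI, clarify)
    fix B x y assume B: "(B, x, y) \<in> sequences \<C> A C"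
    then show "((B, x, y), (B, x, y)) \<in> seq_equiv \<C> A C"
      by (auto simp: seq_equiv_def sequences_def cat_simps intro!: exI[of _ "Ident \<C> B"] is_iso_Ident)
  qed
  show "sym (seq_equiv \<C> A C)"
  proof (rule symI, clarify)
    fix B x y B' x' y' assume asm: "((B, x, y), (B', x', y')) \<in> seq_equiv \<C> A C"
    then have [simp]: "B \<in> Obj \<C>" "B' \<in> Obj \<C>"
      and m [simp]: "x \<in> Mor \<C> A B" "y \<in> Mor \<C> B C" "x' \<in> Mor \<C> A B'" "y' \<in> Mor \<C> B' C"
      by (auto simp: seq_equiv_def sequences_def)
    obtain b b' where b [simp]: "b \<in> Mor \<C> B B'" "b' \<in> Mor \<C> B' B"
      and bb: "Comp \<C> B B' B b' b = Ident \<C> B" "Comp \<C> B' B B' b b' = Ident \<C> B'"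
      and eq: "Comp \<C> A B B' b x = x'" "Comp \<C> B B' C y' b = y"
      using asm by (auto simp: seq_equiv_def is_iso_def)
    have "Comp \<C> A B' B b' x' = x"
      unfolding eq(1)[symmetric] by (simp add: bb cat_simps flip: Comp_assoc)
    moreover have "Comp \<C> B' B C y b' = y'"
      unfolding eq(2)[symmetric] by (simp add: bb cat_simps Comp_assoc)
    moreover have "is_iso \<C> B' B b'" using b bb by (auto simp: is_iso_def)
    ultimately show "((B', x', y'), (B, x, y)) \<in> seq_equiv \<C> A C"
      using asm by (auto simp: seq_equiv_def)
  qed
  show "trans (seq_equiv \<C> A C)"
  proof (rule transI, clarify)
    fix B x y B' x' y' B'' x'' y''
    assume asm: "((B, x, y), (B', x', y')) \<in> seq_equiv \<C> A C"
      "((B', x', y'), (B'', x'', y'')) \<in> seq_equiv \<C> A C"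
    then have [simp]: "B \<in> Obj \<C>" "B' \<in> Obj \<C>" "B'' \<in> Obj \<C>"
      and m [simp]: "x \<in> Mor \<C> A B" "y \<in> Mor \<C> B C" "x' \<in> Mor \<C> A B'" "y' \<in> Mor \<C> B' C"
        "x'' \<in> Mor \<C> A B''" "y'' \<in> Mor \<C> B'' C"
      by (auto simp: seq_equiv_def sequences_def)
    obtain b where b: "is_iso \<C> B B' b" "Comp \<C> A B B' b x = x'" "Comp \<C> B B' C y' b = y"
      using asm by (auto simp: seq_equiv_def)
    obtain b' where b': "is_iso \<C> B' B'' b'" "Comp \<C> A B' B'' b' x' = x''"
      "Comp \<C> B' B'' C y'' b' = y'"
      using asm by (auto simp: seq_equiv_def)
    have [simp]: "b \<in> Mor \<C> B B'" "b' \<in> Mor \<C> B' B''" using b b' by (auto simp: is_iso_def)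
    have "Comp \<C> A B B'' (Comp \<C> B B' B'' b' b) x = x''"
      by (simp add: Comp_assoc b b')
    moreover have "Comp \<C> B B'' C y'' (Comp \<C> B B' B'' b' b) = y"
      by (simp add: b b' flip: Comp_assoc)
    ultimately show "((B, x, y), (B'', x'', y'')) \<in> seq_equiv \<C> A C"
      using asm is_iso_Comp[OF _ _ _ b(1) b'(1)] by (auto simp: seq_equiv_def)
  qed
qed

end


section \<open>Realisations and isomorphisms of extensions\<close>

context realisation
begin

lemma realised_byD:
  assumes "realised_by \<C> E s \<delta> A B C x y"
  shows "A \<in> Obj \<C>" "B \<in> Obj \<C>" "C \<in> Obj \<C>" "\<delta> \<in> carrier (Ext E C A)"
    "x \<in> Mor \<C> A B" "y \<in> Mor \<C> B C"
  using assms by (auto simp: realised_by_def sequences_def)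

text \<open>Two classes of an equivalence relation with a common element coincide, so the equation
  between classes in \<open>realised_by\<close> says no more than that the sequence lies in
  s(\<open>\<delta>\<close>).\<close>

lemma realised_by_iff_mem:
  "realised_by \<C> E s \<delta> A B C x y \<longleftrightarrow> A \<in> Obj \<C> \<and> C \<in> Obj \<C> \<and> \<delta> \<in> carrier (Ext E C A) \<and>
    (B, x, y) \<in> s C A \<delta>"
proof (cases "A \<in> Obj \<C> \<and> C \<in> Obj \<C> \<and> \<delta> \<in> carrier (Ext E C A)")
  case True
  then have eqv: "equiv (sequences \<C> A C) (seq_equiv \<C> A C)"
    and s: "s C A \<delta> \<in> sequences \<C> A C // seq_equiv \<C> A C"
    using equiv_seq_equiv class_of_sequences by simp_all
  have "(B, x, y) \<in> sequences \<C> A C \<and> s C A \<delta> = seq_class \<C> A B C x y \<longleftrightarrow> (B, x, y) \<in> s C A \<delta>"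
  proof
    assume "(B, x, y) \<in> sequences \<C> A C \<and> s C A \<delta> = seq_class \<C> A B C x y"
    then show "(B, x, y) \<in> s C A \<delta>"
      using equiv_class_self[OF eqv] by (auto simp: seq_class_def)
  next
    assume mem: "(B, x, y) \<in> s C A \<delta>"
    then have "(B, x, y) \<in> sequences \<C> A C"
      using in_quotient_imp_subset[OF eqv s] by auto
    moreover have "s C A \<delta> = seq_class \<C> A B C x y"
    proof -
      obtain X where X: "s C A \<delta> = seq_equiv \<C> A C `` {X}" using s by (auto elim: quotientE)
      with mem have "(X, (B, x, y)) \<in> seq_equiv \<C> A C" by simp
      then show ?thesis unfolding seq_class_def X by (rule equiv_class_eq[OF eqv])
    qed
    ultimately show "(B, x, y) \<in> sequences \<C> A C \<and> s C A \<delta> = seq_class \<C> A B C x y" by simp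
  qed
  with True show ?thesis by (auto simp: realised_by_def)
qed (auto simp: realised_by_def)

lemma ex_realised_by:
  assumes "C \<in> Obj \<C>" "A \<in> Obj \<C>" "\<delta> \<in> carrier (Ext E C A)"
  obtains B x y where "realised_by \<C> E s \<delta> A B C x y"
proof -
  have "s C A \<delta> \<noteq> {}"
    using in_quotient_imp_non_empty[OF equiv_seq_equiv class_of_sequences] assms by simp
  then show thesis using that assms by (auto simp: realised_by_iff_mem)
qed

text \<open>s(\<open>\<delta>\<close>) is a full equivalence class. Only the middle term moves here;
  moving the ends changes the extension as well and is the harder statement
  \<open>realised_by_ext_iso\<close>.\<close>

lemma realised_by_is_iso:
  assumes r: "realised_by \<C> E s \<delta> A B C x y" and b: "is_iso \<C> B B' b" and [simp]: "B' \<in> Obj \<C>"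
    and m: "x' \<in> Mor \<C> A B'" "y' \<in> Mor \<C> B' C"
    and eq: "Comp \<C> A B B' b x = x'" "Comp \<C> B B' C y' b = y"
  shows "realised_by \<C> E s \<delta> A B' C x' y'"
proof -
  have "((B, x, y), (B', x', y')) \<in> seq_equiv \<C> A C"
    using realised_byD[OF r] b m eq by (auto simp: seq_equiv_def sequences_def)
  then have "(B', x', y') \<in> s C A \<delta>" using r by (simp add: realised_by_def seq_class_def)
  with realised_byD[OF r] show ?thesis by (simp add: realised_by_iff_mem)
qed

end

context extriangulated_category
begin

text \<open>Apply (ET3) to the zero extension of \<open>B\<close> by any object, mapping \<open>B\<close> by \<open>u\<close> into the
  second summand of its middle term.\<close>

lemma realised_weak_cokernel:
  assumes r: "realised_by \<C> E s \<delta> A B C x y" and [simp]: "K \<in> Obj \<C>"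
    and u [simp]: "u \<in> Mor \<C> B K" and ux: "Comp \<C> A B K u x = \<one>\<^bsub>Hom \<C> A K\<^esub>"
  obtains v where "v \<in> Mor \<C> C K" "u = Comp \<C> B C K v y"
proof -
  note [simp] = realised_byD[OF r]
  let ?P = "Dsum \<C> A K"
  have "comm_group (Ext E K A)" by (simp add: Ext_comm_group)
  then have "monoid (Ext E K A)" by (simp add: comm_group_def group.is_monoid)
  then have "realised_by \<C> E s \<one>\<^bsub>Ext E K A\<^esub> A ?P K (In1 \<C> A K) (Pr2 \<C> A K)"
    by (simp add: realised_by_def sequences_def realise_zero cat_simps monoid.one_closed)
  \<comment> \<open>The left vertical map is zero: both composites of the square vanish. (ET3) then
    completes it on the right by \<open>v\<close>, and pr2 in2 = 1 turns the new square into u = v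
    y.\<close>
  moreover have "Comp \<C> A B ?P (Comp \<C> B K ?P (In2 \<C> A K) u) x
      = Comp \<C> A A ?P (In1 \<C> A K) \<one>\<^bsub>Hom \<C> A A\<^esub>"
    by (simp add: Comp_assoc ux cat_simps)
  ultimately obtain v where "v \<in> Mor \<C> C K"
    "Comp \<C> B ?P K (Pr2 \<C> A K) (Comp \<C> B K ?P (In2 \<C> A K) u) = Comp \<C> B C K v y"
    using ET3[OF r, of "\<one>\<^bsub>Ext E K A\<^esub>" A ?P K "In1 \<C> A K" "Pr2 \<C> A K" "\<one>\<^bsub>Hom \<C> A A\<^esub>"
      "Comp \<C> B K ?P (In2 \<C> A K) u"] by (auto simp: cat_simps)
  then show thesis using that by (simp add: proj_incl_cancel)
qed

text \<open>Such an \<open>e\<close> is \<open>1 + u\<close> with \<open>u \<circ> x = 0\<close> and \<open>y \<circ> u = 0\<close>, so \<open>u\<close> factors through \<open>y\<close> and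
  \<open>u \<circ> u = 0\<close>; the inverse is \<open>1 - u\<close>.\<close>

lemma realised_endo_invertible:
  assumes r: "realised_by \<C> E s \<delta> A B C x y"
    and e [simp]: "e \<in> Mor \<C> B B" and ex: "Comp \<C> A B B e x = x" and ye: "Comp \<C> B B C y e = y"
  obtains e' where "e' \<in> Mor \<C> B B" "Comp \<C> B B B e' e = Ident \<C> B" "Comp \<C> B B B e e' = Ident \<C> B"
proof -
  note [simp] = realised_byD[OF r]
  interpret H: comm_group "Hom \<C> B B" by (simp add: Hom_comm_group)
  \<comment> \<open>In additive notation \<open>n\<close> is -1, \<open>u\<close> is e - 1 and
    \<open>w\<close> is -u.\<close>
  define n where "n = inv\<^bsub>Hom \<C> B B\<^esub> Ident \<C> B"
  define u where "u = e \<otimes>\<^bsub>Hom \<C> B B\<^esub> n"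
  define w where "w = inv\<^bsub>Hom \<C> B B\<^esub> u"
  have [simp]: "n \<in> Mor \<C> B B" by (simp add: n_def cat_simps)
  have [simp]: "u \<in> Mor \<C> B B" by (simp add: u_def)
  have [simp]: "w \<in> Mor \<C> B B" by (simp add: w_def)
  have n1: "Ident \<C> B \<otimes>\<^bsub>Hom \<C> B B\<^esub> n = \<one>\<^bsub>Hom \<C> B B\<^esub>" by (simp add: n_def cat_simps)
  have uw: "u \<otimes>\<^bsub>Hom \<C> B B\<^esub> w = \<one>\<^bsub>Hom \<C> B B\<^esub>" by (simp add: w_def)
  have eu: "e = Ident \<C> B \<otimes>\<^bsub>Hom \<C> B B\<^esub> u"
  proof -
    have "Ident \<C> B \<otimes>\<^bsub>Hom \<C> B B\<^esub> u = e \<otimes>\<^bsub>Hom \<C> B B\<^esub> (Ident \<C> B \<otimes>\<^bsub>Hom \<C> B B\<^esub> n)"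
      by (simp add: u_def H.m_ac cat_simps)
    then show ?thesis by (simp add: n1)
  qed
  have "Comp \<C> A B B u x = Comp \<C> A B B (Ident \<C> B \<otimes>\<^bsub>Hom \<C> B B\<^esub> n) x"
    unfolding u_def by (simp add: cat_simps ex del: H.l_inv H.r_inv)
  then have ux: "Comp \<C> A B B u x = \<one>\<^bsub>Hom \<C> A B\<^esub>" by (simp add: n1 cat_simps)
  obtain v where v [simp]: "v \<in> Mor \<C> C B" and uv: "u = Comp \<C> B C B v y"
    by (rule realised_weak_cokernel[OF r _ _ ux]) auto
  have "Comp \<C> B B C y u = Comp \<C> B B C y (Ident \<C> B \<otimes>\<^bsub>Hom \<C> B B\<^esub> n)"
    unfolding u_def by (simp add: cat_simps ye del: H.l_inv H.r_inv)
  then have yu: "Comp \<C> B B C y u = \<one>\<^bsub>Hom \<C> B C\<^esub>" by (simp add: n1 cat_simps)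
  have "Comp \<C> B B B u u = Comp \<C> B B B (Comp \<C> B C B v y) u" by (simp flip: uv)
  then have uu: "Comp \<C> B B B u u = \<one>\<^bsub>Hom \<C> B B\<^esub>" by (simp add: Comp_assoc yu cat_simps)
  \<comment> \<open>Expanding u (u + w) = u 0 = 0 leaves only this term, since u u = 0.\<close>
  have uw0: "Comp \<C> B B B u w = \<one>\<^bsub>Hom \<C> B B\<^esub>"
  proof -
    have "Comp \<C> B B B u (u \<otimes>\<^bsub>Hom \<C> B B\<^esub> w) = \<one>\<^bsub>Hom \<C> B B\<^esub>" by (simp only: uw) (simp add: cat_simps)
    then show ?thesis by (simp add: Comp_add_right uu Comp_closed)
  qed
  have wu0: "Comp \<C> B B B w u = \<one>\<^bsub>Hom \<C> B B\<^esub>"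
  proof -
    have "Comp \<C> B B B (u \<otimes>\<^bsub>Hom \<C> B B\<^esub> w) u = \<one>\<^bsub>Hom \<C> B B\<^esub>" by (simp only: uw) (simp add: cat_simps)
    then show ?thesis by (simp add: Comp_add_left uu Comp_closed)
  qed
  let ?e' = "Ident \<C> B \<otimes>\<^bsub>Hom \<C> B B\<^esub> w"
  have "Comp \<C> B B B ?e' e = Ident \<C> B" "Comp \<C> B B B e ?e' = Ident \<C> B"
    unfolding eu using uw by (simp_all add: cat_simps uw0 wu0 H.m_assoc) (simp_all add: H.m_comm)
  then show thesis using that[of ?e'] by (simp add: cat_simps)
qed

text \<open>Take any realisation of the transported extension and lift (a, c) and (a', c') to maps
  \<open>b\<close> and \<open>b'\<close> of middle terms. The composites b' b and b b' fix both maps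
  of their sequences, hence are invertible by \<open>realised_endo_invertible\<close>, and so
  \<open>b\<close> is an isomorphism. It exhibits the sequence with ends changed by hand as
  equivalent to the chosen one.\<close>

lemma realised_by_ext_iso:
  assumes r: "realised_by \<C> E s \<delta> A B C x y"
    and obj [simp]: "A' \<in> Obj \<C>" "C' \<in> Obj \<C>"
    and a [simp]: "a \<in> Mor \<C> A A'" "a' \<in> Mor \<C> A' A"
    and aa: "Comp \<C> A A' A a' a = Ident \<C> A" "Comp \<C> A' A A' a a' = Ident \<C> A'"
    and c [simp]: "c \<in> Mor \<C> C C'" "c' \<in> Mor \<C> C' C"
    and cc: "Comp \<C> C C' C c' c = Ident \<C> C" "Comp \<C> C' C C' c c' = Ident \<C> C'"
  shows "realised_by \<C> E s (ExtMap E C A C' A' c' a \<delta>) A' B C' (Comp \<C> A' A B x a') (Comp \<C> B C C' c y)"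
proof -
  note [simp] = realised_byD[OF r]
  define \<epsilon> where "\<epsilon> = ExtMap E C A C' A' c' a \<delta>"
  have \<epsilon> [simp]: "\<epsilon> \<in> carrier (Ext E C' A')" by (simp add: \<epsilon>_def ExtMap_closed)
  obtain B' x' y' where r': "realised_by \<C> E s \<epsilon> A' B' C' x' y'"
    by (rule ex_realised_by[of C' A' \<epsilon>]) simp_all
  note [simp] = realised_byD[OF r']
  \<comment> \<open>Functoriality merges the two pullbacks into one along c' c = 1, leaving the
    pushforward of \<open>\<delta>\<close> along \<open>a\<close>.\<close>
  have "pull \<C> E C' A' C c \<epsilon> = push \<C> E C A A' a \<delta>"
    unfolding \<epsilon>_def pull_def push_def
    by (subst ExtMap_Comp[symmetric]) (simp_all add: cat_simps cc)
  then have "ext_morphism \<C> E C A \<delta> C' A' \<epsilon> a c" by (simp add: ext_morphism_def)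
  then obtain b where b [simp]: "b \<in> Mor \<C> B B'"
    and bx: "Comp \<C> A B B' b x = Comp \<C> A A' B' x' a"
    and yb: "Comp \<C> B B' C' y' b = Comp \<C> B C C' c y"
    using realise_morphism[OF r r'] by blast
  have "push \<C> E C' A' A a' \<epsilon> = pull \<C> E C A C' c' \<delta>"
    unfolding \<epsilon>_def pull_def push_def
    by (subst ExtMap_Comp[symmetric]) (simp_all add: cat_simps aa)
  then have "ext_morphism \<C> E C' A' \<epsilon> C A \<delta> a' c'" by (simp add: ext_morphism_def)
  then obtain b' where b' [simp]: "b' \<in> Mor \<C> B' B"
    and b'x: "Comp \<C> A' B' B b' x' = Comp \<C> A' A B x a'"
    and yb': "Comp \<C> B' B C y b' = Comp \<C> B' C' C c' y'"
    using realise_morphism[OF r' r] by blast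
  have 1: "Comp \<C> A B B (Comp \<C> B B' B b' b) x = x"
  proof -
    have "Comp \<C> A B B (Comp \<C> B B' B b' b) x = Comp \<C> A A' B (Comp \<C> A' B' B b' x') a"
      by (simp add: Comp_assoc bx)
    then show ?thesis by (simp add: b'x Comp_assoc aa cat_simps)
  qed
  have 2: "Comp \<C> B B C y (Comp \<C> B B' B b' b) = y"
  proof -
    have "Comp \<C> B B C y (Comp \<C> B B' B b' b) = Comp \<C> B B' C (Comp \<C> B' B C y b') b"
      by (simp add: Comp_assoc)
    also have "\<dots> = Comp \<C> B C C (Comp \<C> C C' C c' c) y" by (simp add: yb' Comp_assoc yb)
    finally show ?thesis by (simp add: cc cat_simps)
  qed
  have 3: "Comp \<C> A' B' B' (Comp \<C> B' B B' b b') x' = x'"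
  proof -
    have "Comp \<C> A' B' B' (Comp \<C> B' B B' b b') x' = Comp \<C> A' A B' (Comp \<C> A B B' b x) a'"
      by (simp add: Comp_assoc b'x)
    then show ?thesis by (simp add: bx Comp_assoc aa cat_simps)
  qed
  have 4: "Comp \<C> B' B' C' y' (Comp \<C> B' B B' b b') = y'"
  proof -
    have "Comp \<C> B' B' C' y' (Comp \<C> B' B B' b b') = Comp \<C> B' B C' (Comp \<C> B B' C' y' b) b'"
      by (simp add: Comp_assoc)
    also have "\<dots> = Comp \<C> B' C' C' (Comp \<C> C' C C' c c') y'" by (simp add: yb Comp_assoc yb')
    finally show ?thesis by (simp add: cc cat_simps)
  qed
  \<comment> \<open>An inverse \<open>e\<close> of b' b makes e b' a left inverse of
    \<open>b\<close>; likewise an inverse \<open>e'\<close> of b b' makes b' e' a right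
    inverse.\<close>
  obtain e where e [simp]: "e \<in> Mor \<C> B B" "Comp \<C> B B B e (Comp \<C> B B' B b' b) = Ident \<C> B"
    by (rule realised_endo_invertible[OF r _ 1 2]) (auto simp: cat_simps)
  obtain e' where e' [simp]: "e' \<in> Mor \<C> B' B'"
    "Comp \<C> B' B' B' (Comp \<C> B' B B' b b') e' = Ident \<C> B'"
    by (rule realised_endo_invertible[OF r' _ 3 4]) (auto simp: cat_simps)
  have "is_iso \<C> B B' b"
    by (rule is_iso_of_one_sided_inverses[of B B' b "Comp \<C> B' B B e b'" "Comp \<C> B' B' B b' e'"])
      (use e(2) e'(2) in \<open>simp_all add: cat_simps Comp_assoc del: e(2) e'(2)\<close>)
  moreover have "Comp \<C> A' B B' b (Comp \<C> A' A B x a') = x'"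
  proof -
    have "Comp \<C> A' A B' (Comp \<C> A B B' b x) a' = x'"
      by (simp add: bx Comp_assoc aa cat_simps)
    then show ?thesis by (simp add: Comp_assoc)
  qed
  ultimately have "((B, Comp \<C> A' A B x a', Comp \<C> B C C' c y), (B', x', y')) \<in> seq_equiv \<C> A' C'"
    using yb by (auto simp: seq_equiv_def sequences_def cat_simps)
  then have "((B', x', y'), (B, Comp \<C> A' A B x a', Comp \<C> B C C' c y)) \<in> seq_equiv \<C> A' C'"
    using equiv_seq_equiv[of A' C'] by (simp add: equiv_def symD)
  then have "(B, Comp \<C> A' A B x a', Comp \<C> B C C' c y) \<in> s C' A' \<epsilon>"
    using r' by (simp add: realised_by_def seq_class_def)
  then show ?thesis by (simp add: realised_by_iff_mem flip: \<epsilon>_def)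
qed

end


section \<open>Pulling back an extriangulated structure along an equivalence\<close>

text \<open>The groups themselves are reused, so extensions keep the type \<open>'e\<close> and can
  be compared across the two categories by plain equality.\<close>

definition pullback_ext ::
    "('p \<Rightarrow> 'o) \<Rightarrow> ('p \<Rightarrow> 'p \<Rightarrow> 'n \<Rightarrow> 'm) \<Rightarrow> ('o, 'm, 'e) ext_bifunctor \<Rightarrow> ('p, 'n, 'e) ext_bifunctor"
  where "pullback_ext Q Qm E = \<lparr>
    Ext = (\<lambda>C A. Ext E (Q C) (Q A)),
    ExtMap = (\<lambda>C A C' A' c a. ExtMap E (Q C) (Q A) (Q C') (Q A') (Qm C' C c) (Qm A A' a))\<rparr>"

text \<open>A preimage needs no choice of representative. That it is one whole equivalence class has
  to be proved; see \<open>pullback_corr_class\<close>.\<close>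

definition pullback_corr ::
    "('p, 'n) add_cat \<Rightarrow> ('p \<Rightarrow> 'o) \<Rightarrow> ('p \<Rightarrow> 'p \<Rightarrow> 'n \<Rightarrow> 'm) \<Rightarrow>
      ('o, 'm, 'e) correspondence \<Rightarrow> ('p, 'n, 'e) correspondence"
  where "pullback_corr \<D> Q Qm s C A \<delta> =
    {(B, x, y) \<in> sequences \<D> A C. (Q B, Qm A B x, Qm B C y) \<in> s (Q C) (Q A) \<delta>}"

text \<open>Objects are hit on the nose and not merely up to isomorphism. Thus a sequence in
  \<open>\<C>\<close> between images of objects of \<open>\<D>\<close> is itself the image of a
  sequence, with no adjustment of its middle term.\<close>

locale extriangulated_pullback = extriangulated_category \<C> E s + additive_functor \<D> \<C> Q Qm
  for \<C> :: "('o, 'm) add_cat" and E :: "('o, 'm, 'e) ext_bifunctor"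
    and s :: "('o, 'm, 'e) correspondence"
    and \<D> :: "('p, 'n) add_cat" and Q :: "'p \<Rightarrow> 'o" and Qm :: "'p \<Rightarrow> 'p \<Rightarrow> 'n \<Rightarrow> 'm" +
  assumes fully_faithful:
      "\<lbrakk>A \<in> Obj \<D>; B \<in> Obj \<D>\<rbrakk> \<Longrightarrow> bij_betw (Qm A B) (Mor \<D> A B) (Mor \<C> (Q A) (Q B))"
    and surj_on_objects: "X \<in> Obj \<C> \<Longrightarrow> \<exists>A\<in>Obj \<D>. Q A = X"
begin

abbreviation "E' \<equiv> pullback_ext Q Qm E"
abbreviation "s' \<equiv> pullback_corr \<D> Q Qm s"

lemma Ext_pullback [simp]: "Ext E' C A = Ext E (Q C) (Q A)"
  and ExtMap_pullback [simp]: "ExtMap E' C A C' A' c a \<delta> =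
    ExtMap E (Q C) (Q A) (Q C') (Q A') (Qm C' C c) (Qm A A' a) \<delta>"
  by (simp_all add: pullback_ext_def)

declare Fo_closed [simp]

section \<open>Equations, isomorphisms and sequences seen through \<open>Q\<close>\<close>

lemma Qm_closed [simp]:
  "\<lbrakk>A \<in> Obj \<D>; B \<in> Obj \<D>; f \<in> Mor \<D> A B\<rbrakk> \<Longrightarrow> Qm A B f \<in> Mor \<C> (Q A) (Q B)"
  using Fm_hom by (rule hom_in_carrier)

lemma Qm_add:
  "\<lbrakk>A \<in> Obj \<D>; B \<in> Obj \<D>; f \<in> Mor \<D> A B; g \<in> Mor \<D> A B\<rbrakk>
    \<Longrightarrow> Qm A B (f \<otimes>\<^bsub>Hom \<D> A B\<^esub> g) = Qm A B f \<otimes>\<^bsub>Hom \<C> (Q A) (Q B)\<^esub> Qm A B g"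
  using Fm_hom by (simp add: hom_mult)

lemma Qm_zero: "\<lbrakk>A \<in> Obj \<D>; B \<in> Obj \<D>\<rbrakk> \<Longrightarrow> Qm A B \<one>\<^bsub>Hom \<D> A B\<^esub> = \<one>\<^bsub>Hom \<C> (Q A) (Q B)\<^esub>"
  by (rule hom_one[OF Fm_hom]) (simp_all add: src.Hom_group Hom_group)

lemma Qm_eq_iff:
  "\<lbrakk>A \<in> Obj \<D>; B \<in> Obj \<D>; f \<in> Mor \<D> A B; g \<in> Mor \<D> A B\<rbrakk> \<Longrightarrow> Qm A B f = Qm A B g \<longleftrightarrow> f = g"
  using fully_faithful by (auto simp: bij_betw_def inj_on_def)

lemma Qm_surj:
  assumes "A \<in> Obj \<D>" "B \<in> Obj \<D>" "f \<in> Mor \<C> (Q A) (Q B)"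
  obtains g where "g \<in> Mor \<D> A B" "f = Qm A B g"
  using assms fully_faithful[of A B] by (auto simp: bij_betw_def)

lemma Q_surj:
  assumes "X \<in> Obj \<C>" obtains A where "A \<in> Obj \<D>" "X = Q A"
  using assms surj_on_objects by blast

text \<open>Functoriality preserves a commutative triangle and faithfulness reflects it. Through
  this and its version for squares, equations pass between \<open>\<C>\<close> and
  \<open>\<D>\<close>.\<close>

lemma Comp_eq_iff:
  assumes [simp]: "A \<in> Obj \<D>" "B \<in> Obj \<D>" "K \<in> Obj \<D>" "f \<in> Mor \<D> A B" "g \<in> Mor \<D> B K" "h \<in> Mor \<D> A K"
  shows "Comp \<C> (Q A) (Q B) (Q K) (Qm B K g) (Qm A B f) = Qm A K h \<longleftrightarrow> Comp \<D> A B K g f = h"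
  by (simp add: src.Comp_closed Qm_eq_iff flip: Fm_Comp)

lemma Comp_eq_Comp_iff:
  assumes [simp]: "A \<in> Obj \<D>" "B \<in> Obj \<D>" "B' \<in> Obj \<D>" "K \<in> Obj \<D>"
    "f \<in> Mor \<D> A B" "g \<in> Mor \<D> B K" "f' \<in> Mor \<D> A B'" "g' \<in> Mor \<D> B' K"
  shows "Comp \<C> (Q A) (Q B) (Q K) (Qm B K g) (Qm A B f)
      = Comp \<C> (Q A) (Q B') (Q K) (Qm B' K g') (Qm A B' f')
    \<longleftrightarrow> Comp \<D> A B K g f = Comp \<D> A B' K g' f'"
  by (simp add: src.Comp_closed Qm_eq_iff flip: Fm_Comp)

lemma is_iso_Qm_iff:
  assumes [simp]: "A \<in> Obj \<D>" "B \<in> Obj \<D>" "f \<in> Mor \<D> A B"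
  shows "is_iso \<C> (Q A) (Q B) (Qm A B f) \<longleftrightarrow> is_iso \<D> A B f"
proof
  assume "is_iso \<C> (Q A) (Q B) (Qm A B f)"
  then obtain h where "h \<in> Mor \<C> (Q B) (Q A)"
    and h: "Comp \<C> (Q A) (Q B) (Q A) h (Qm A B f) = Ident \<C> (Q A)"
      "Comp \<C> (Q B) (Q A) (Q B) (Qm A B f) h = Ident \<C> (Q B)"
    by (auto simp: is_iso_def)
  then obtain g where [simp]: "g \<in> Mor \<D> B A" and "h = Qm B A g"
    using Qm_surj[of B A h] by auto
  with h show "is_iso \<D> A B f"
    by (auto simp: is_iso_def Comp_eq_iff src.cat_simps simp flip: Fm_Ident)
next
  assume "is_iso \<D> A B f"
  then obtain g where "g \<in> Mor \<D> B A"
    "Comp \<D> A B A g f = Ident \<D> A" "Comp \<D> B A B f g = Ident \<D> B"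
    by (auto simp: is_iso_def)
  then show "is_iso \<C> (Q A) (Q B) (Qm A B f)"
    by (auto simp: is_iso_def Comp_eq_iff src.cat_simps simp flip: Fm_Ident intro!: bexI[of _ "Qm B A g"])
qed

lemma sequences_Qm:
  "\<lbrakk>A \<in> Obj \<D>; C \<in> Obj \<D>; (B, x, y) \<in> sequences \<D> A C\<rbrakk>
    \<Longrightarrow> (Q B, Qm A B x, Qm B C y) \<in> sequences \<C> (Q A) (Q C)"
  by (auto simp: sequences_def)

text \<open>An isomorphism of middle terms in \<open>\<C>\<close> lifts by fullness, and its lift is
  an isomorphism compatible with the sequences by faithfulness. Hence \<open>Q\<close> is injective
  on classes of sequences.\<close>

lemma seq_equiv_Qm_iff:
  assumes [simp]: "A \<in> Obj \<D>" "C \<in> Obj \<D>"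
    and seq: "(B, x, y) \<in> sequences \<D> A C" "(B', x', y') \<in> sequences \<D> A C"
  shows "((Q B, Qm A B x, Qm B C y), (Q B', Qm A B' x', Qm B' C y')) \<in> seq_equiv \<C> (Q A) (Q C)
    \<longleftrightarrow> ((B, x, y), (B', x', y')) \<in> seq_equiv \<D> A C"
proof -
  have [simp]: "B \<in> Obj \<D>" "B' \<in> Obj \<D>" "x \<in> Mor \<D> A B" "y \<in> Mor \<D> B C"
    "x' \<in> Mor \<D> A B'" "y' \<in> Mor \<D> B' C"
    using seq by (auto simp: sequences_def)
  have eq: "is_iso \<D> B B' b \<and> Comp \<D> A B B' b x = x' \<and> Comp \<D> B B' C y' b = y \<longleftrightarrow>
      is_iso \<C> (Q B) (Q B') (Qm B B' b) \<and>
      Comp \<C> (Q A) (Q B) (Q B') (Qm B B' b) (Qm A B x) = Qm A B' x' \<and>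
      Comp \<C> (Q B) (Q B') (Q C) (Qm B' C y') (Qm B B' b) = Qm B C y"
    if [simp]: "b \<in> Mor \<D> B B'" for b
    by (simp add: is_iso_Qm_iff Comp_eq_iff)
  have iso_mem: "f \<in> Mor \<D> B B'" if "is_iso \<D> B B' f" for f using that by (simp add: is_iso_def)
  show ?thesis
  proof
    assume "((Q B, Qm A B x, Qm B C y), (Q B', Qm A B' x', Qm B' C y')) \<in> seq_equiv \<C> (Q A) (Q C)"
    then obtain h where h: "is_iso \<C> (Q B) (Q B') h"
      "Comp \<C> (Q A) (Q B) (Q B') h (Qm A B x) = Qm A B' x'"
      "Comp \<C> (Q B) (Q B') (Q C) (Qm B' C y') h = Qm B C y"
      by (auto simp: seq_equiv_def)
    then have "h \<in> Mor \<C> (Q B) (Q B')" by (simp add: is_iso_def)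
    then obtain b where "b \<in> Mor \<D> B B'" "h = Qm B B' b" using Qm_surj[of B B' h] by auto
    with h eq[of b] show "((B, x, y), (B', x', y')) \<in> seq_equiv \<D> A C"
      using seq by (auto simp: seq_equiv_def)
  next
    assume "((B, x, y), (B', x', y')) \<in> seq_equiv \<D> A C"
    then obtain b where "is_iso \<D> B B' b \<and> Comp \<D> A B B' b x = x' \<and> Comp \<D> B B' C y' b = y"
      by (auto simp: seq_equiv_def)
    with eq[of b] iso_mem[of b]
    show "((Q B, Qm A B x, Qm B C y), (Q B', Qm A B' x', Qm B' C y')) \<in> seq_equiv \<C> (Q A) (Q C)"
      using seq sequences_Qm by (auto simp: seq_equiv_def)
  qed
qed

lemma push_pullback [simp]:
  "C \<in> Obj \<D> \<Longrightarrow> push \<D> E' C A A' a \<delta> = push \<C> E (Q C) (Q A) (Q A') (Qm A A' a) \<delta>"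
  by (simp add: push_def Fm_Ident)

lemma pull_pullback [simp]:
  "A \<in> Obj \<D> \<Longrightarrow> pull \<D> E' C A C' c \<delta> = pull \<C> E (Q C) (Q A) (Q C') (Qm C' C c) \<delta>"
  by (simp add: pull_def Fm_Ident)

section \<open>The pulled-back bifunctor and realisation\<close>

lemma biadditive_functor_pullback: "biadditive_functor \<D> E'"
proof (intro biadditive_functor.intro src.additive_category_axioms biadditive_functor_axioms.intro)
  fix C A assume [simp]: "C \<in> Obj \<D>" "A \<in> Obj \<D>"
  show "comm_group (Ext E' C A)" by (simp add: Ext_comm_group)
  show "ExtMap E' C A C A (Ident \<D> C) (Ident \<D> A) \<delta> = \<delta>" if "\<delta> \<in> carrier (Ext E' C A)" for \<delta>
    using that by (simp add: Fm_Ident ExtMap_Ident)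
  fix C' A' assume [simp]: "C' \<in> Obj \<D>" "A' \<in> Obj \<D>"
  show "ExtMap E' C A C' A' c a \<in> hom (Ext E' C A) (Ext E' C' A')"
    if "c \<in> Mor \<D> C' C" "a \<in> Mor \<D> A A'" for c a
    using that by (simp add: pullback_ext_def ExtMap_hom)
  show "ExtMap E' C A C'' A'' (Comp \<D> C'' C' C c c') (Comp \<D> A A' A'' a' a) \<delta> =
      ExtMap E' C' A' C'' A'' c' a' (ExtMap E' C A C' A' c a \<delta>)"
    if "C'' \<in> Obj \<D>" "A'' \<in> Obj \<D>" "c \<in> Mor \<D> C' C" "c' \<in> Mor \<D> C'' C'"
      "a \<in> Mor \<D> A A'" "a' \<in> Mor \<D> A' A''" "\<delta> \<in> carrier (Ext E' C A)" for C'' A'' c c' a a' \<delta>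
    using that by (simp add: Fm_Comp ExtMap_Comp)
  show "push \<D> E' C A A' (a \<otimes>\<^bsub>Hom \<D> A A'\<^esub> b) \<delta> =
      push \<D> E' C A A' a \<delta> \<otimes>\<^bsub>Ext E' C A'\<^esub> push \<D> E' C A A' b \<delta>"
    if "a \<in> Mor \<D> A A'" "b \<in> Mor \<D> A A'" "\<delta> \<in> carrier (Ext E' C A)" for a b \<delta>
    using that by (simp add: Qm_add push_add)
  show "pull \<D> E' C A C' (c \<otimes>\<^bsub>Hom \<D> C' C\<^esub> d) \<delta> =
      pull \<D> E' C A C' c \<delta> \<otimes>\<^bsub>Ext E' C' A\<^esub> pull \<D> E' C A C' d \<delta>"
    if "c \<in> Mor \<D> C' C" "d \<in> Mor \<D> C' C" "\<delta> \<in> carrier (Ext E' C A)" for c d \<delta>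
    using that by (simp add: Qm_add pull_add)
qed

text \<open>By \<open>seq_equiv_Qm_iff\<close> the preimage of a class is a single class as soon as
  it contains one sequence.\<close>

lemma pullback_corr_eq_seq_class:
  assumes [simp]: "A \<in> Obj \<D>" "C \<in> Obj \<D>" and seq: "(B, x, y) \<in> sequences \<D> A C"
    and r: "realised_by \<C> E s \<delta> (Q A) (Q B) (Q C) (Qm A B x) (Qm B C y)"
  shows "s' C A \<delta> = seq_class \<D> A B C x y"
proof -
  have "s (Q C) (Q A) \<delta> = seq_class \<C> (Q A) (Q B) (Q C) (Qm A B x) (Qm B C y)"
    using r by (simp add: realised_by_def)
  then have "(B', x', y') \<in> s' C A \<delta> \<longleftrightarrow> (B', x', y') \<in> sequences \<D> A C \<and>
      ((Q B, Qm A B x, Qm B C y), (Q B', Qm A B' x', Qm B' C y')) \<in> seq_equiv \<C> (Q A) (Q C)"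
    for B' x' y'
    by (simp add: pullback_corr_def seq_class_def)
  then have "(B', x', y') \<in> s' C A \<delta> \<longleftrightarrow> (B', x', y') \<in> seq_class \<D> A B C x y" for B' x' y'
    using seq_equiv_Qm_iff[OF _ _ seq] by (auto simp: seq_class_def seq_equiv_def[of \<D>])
  then show ?thesis by auto
qed

lemma pullback_corr_class:
  assumes [simp]: "C \<in> Obj \<D>" "A \<in> Obj \<D>" and \<delta>: "\<delta> \<in> carrier (Ext E' C A)"
  shows "s' C A \<delta> \<in> sequences \<D> A C // seq_equiv \<D> A C"
proof -
  obtain X f g where r: "realised_by \<C> E s \<delta> (Q A) X (Q C) f g"
    using ex_realised_by[of "Q C" "Q A" \<delta>] \<delta> by auto
  \<comment> \<open>Nonemptiness of the preimage: the middle term lifts by strict surjectivity on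
    objects, the two maps by fullness.\<close>
  obtain B where B: "B \<in> Obj \<D>" "X = Q B" using realised_byD[OF r] by (auto elim: Q_surj)
  obtain x where x: "x \<in> Mor \<D> A B" "f = Qm A B x"
    using realised_byD[OF r] B by (auto elim: Qm_surj[rotated 2])
  obtain y where y: "y \<in> Mor \<D> B C" "g = Qm B C y"
    using realised_byD[OF r] B by (auto elim: Qm_surj[rotated 2])
  have seq: "(B, x, y) \<in> sequences \<D> A C" using B x y by (simp add: sequences_def)
  then have "s' C A \<delta> = seq_class \<D> A B C x y"
    using r by (intro pullback_corr_eq_seq_class) (simp_all add: B x y)
  with seq show ?thesis by (simp add: seq_class_def quotientI)
qed

text \<open>The bridge for transferring the axioms: being realised in \<open>\<D>\<close> becomes a
  statement about the image sequence in \<open>\<C>\<close>, with the same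
  \<open>\<delta>\<close>.\<close>

lemma realised_by_pullback_iff:
  "realised_by \<D> E' s' \<delta> A B C x y \<longleftrightarrow> A \<in> Obj \<D> \<and> C \<in> Obj \<D> \<and> (B, x, y) \<in> sequences \<D> A C \<and>
    realised_by \<C> E s \<delta> (Q A) (Q B) (Q C) (Qm A B x) (Qm B C y)"
proof
  assume asm: "realised_by \<D> E' s' \<delta> A B C x y"
  then have "(B, x, y) \<in> s' C A \<delta>"
    using equiv_class_self[OF src.equiv_seq_equiv] by (simp add: realised_by_def seq_class_def)
  then have "(Q B, Qm A B x, Qm B C y) \<in> s (Q C) (Q A) \<delta>" by (simp add: pullback_corr_def)
  with asm show "A \<in> Obj \<D> \<and> C \<in> Obj \<D> \<and> (B, x, y) \<in> sequences \<D> A C \<and>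
      realised_by \<C> E s \<delta> (Q A) (Q B) (Q C) (Qm A B x) (Qm B C y)"
    unfolding realised_by_iff_mem[of \<delta> "Q A"] by (simp add: realised_by_def)
next
  assume "A \<in> Obj \<D> \<and> C \<in> Obj \<D> \<and> (B, x, y) \<in> sequences \<D> A C \<and>
      realised_by \<C> E s \<delta> (Q A) (Q B) (Q C) (Qm A B x) (Qm B C y)"
  then show "realised_by \<D> E' s' \<delta> A B C x y"
    using pullback_corr_eq_seq_class[of A C B x y \<delta>] realised_byD(4)[of \<delta> "Q A"]
    by (auto simp: realised_by_def)
qed

lemma realised_by_pullbackD:
  assumes "realised_by \<D> E' s' \<delta> A B C x y"
  shows "A \<in> Obj \<D>" "B \<in> Obj \<D>" "C \<in> Obj \<D>" "x \<in> Mor \<D> A B" "y \<in> Mor \<D> B C"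
    "realised_by \<C> E s \<delta> (Q A) (Q B) (Q C) (Qm A B x) (Qm B C y)"
  using assms by (auto simp: realised_by_pullback_iff sequences_def)

lemma realised_by_pullbackI:
  "\<lbrakk>A \<in> Obj \<D>; B \<in> Obj \<D>; C \<in> Obj \<D>; x \<in> Mor \<D> A B; y \<in> Mor \<D> B C;
    realised_by \<C> E s \<delta> (Q A) (Q B) (Q C) (Qm A B x) (Qm B C y)\<rbrakk>
    \<Longrightarrow> realised_by \<D> E' s' \<delta> A B C x y"
  by (auto simp: realised_by_pullback_iff sequences_def)

lemma ext_morphism_pullback_iff:
  assumes "A \<in> Obj \<D>" "C \<in> Obj \<D>" "A' \<in> Obj \<D>" "C' \<in> Obj \<D>" "a \<in> Mor \<D> A A'" "c \<in> Mor \<D> C C'"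
  shows "ext_morphism \<D> E' C A \<delta> C' A' \<delta>' a c \<longleftrightarrow>
    ext_morphism \<C> E (Q C) (Q A) \<delta> (Q C') (Q A') \<delta>' (Qm A A' a) (Qm C C' c)"
  using assms by (simp add: ext_morphism_def)

lemma realisation_pullback: "realisation \<D> E' s'"
proof (intro realisation.intro biadditive_functor_pullback realisation_axioms.intro)
  show "s' C A \<delta> \<in> sequences \<D> A C // seq_equiv \<D> A C"
    if "C \<in> Obj \<D>" "A \<in> Obj \<D>" "\<delta> \<in> carrier (Ext E' C A)" for C A \<delta>
    using that by (rule pullback_corr_class)
  fix \<delta> A B C x y \<delta>' A' B' C' x' y' a c
  assume r: "realised_by \<D> E' s' \<delta> A B C x y" and r': "realised_by \<D> E' s' \<delta>' A' B' C' x' y'"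
    and m: "ext_morphism \<D> E' C A \<delta> C' A' \<delta>' a c"
  note [simp] = realised_by_pullbackD[OF r] realised_by_pullbackD[OF r']
  have [simp]: "a \<in> Mor \<D> A A'" "c \<in> Mor \<D> C C'" using m by (simp_all add: ext_morphism_def)
  obtain h where h: "h \<in> Mor \<C> (Q B) (Q B')"
    "Comp \<C> (Q A) (Q B) (Q B') h (Qm A B x) = Comp \<C> (Q A) (Q A') (Q B') (Qm A' B' x') (Qm A A' a)"
    "Comp \<C> (Q B) (Q B') (Q C') (Qm B' C' y') h = Comp \<C> (Q B) (Q C) (Q C') (Qm C C' c) (Qm B C y)"
    using realise_morphism[OF realised_by_pullbackD(6)[OF r] realised_by_pullbackD(6)[OF r']] m
    by (auto simp: ext_morphism_pullback_iff)
  obtain b where [simp]: "b \<in> Mor \<D> B B'" and "h = Qm B B' b"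
    by (rule Qm_surj[OF _ _ h(1)]) auto
  with h show "\<exists>b\<in>Mor \<D> B B'. Comp \<D> A B B' b x = Comp \<D> A A' B' x' a \<and>
      Comp \<D> B B' C' y' b = Comp \<D> B C C' c y"
    by (auto simp: Comp_eq_Comp_iff)
qed


section \<open>The comparison isomorphism for direct sums\<close>

definition dsum_cmp :: "'p \<Rightarrow> 'p \<Rightarrow> 'm"
  where "dsum_cmp A B =
    Comp \<C> (Dsum \<C> (Q A) (Q B)) (Q A) (Q (Dsum \<D> A B))
      (Qm A (Dsum \<D> A B) (In1 \<D> A B)) (Pr1 \<C> (Q A) (Q B))
    \<otimes>\<^bsub>Hom \<C> (Dsum \<C> (Q A) (Q B)) (Q (Dsum \<D> A B))\<^esub>
    Comp \<C> (Dsum \<C> (Q A) (Q B)) (Q B) (Q (Dsum \<D> A B))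
      (Qm B (Dsum \<D> A B) (In2 \<D> A B)) (Pr2 \<C> (Q A) (Q B))"

text \<open>Dual to \<open>dsum_cmp\<close>: that map out of the sum in \<open>\<C>\<close> has the
  images of the inclusions as its components, while this map into it has the images of the
  projections. An additive functor keeps the biproduct identities, so the two are inverse to each
  other.\<close>

definition dsum_cmp_inv :: "'p \<Rightarrow> 'p \<Rightarrow> 'm"
  where "dsum_cmp_inv A B =
    Comp \<C> (Q (Dsum \<D> A B)) (Q A) (Dsum \<C> (Q A) (Q B))
      (In1 \<C> (Q A) (Q B)) (Qm (Dsum \<D> A B) A (Pr1 \<D> A B))
    \<otimes>\<^bsub>Hom \<C> (Q (Dsum \<D> A B)) (Dsum \<C> (Q A) (Q B))\<^esub>
    Comp \<C> (Q (Dsum \<D> A B)) (Q B) (Dsum \<C> (Q A) (Q B))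
      (In2 \<C> (Q A) (Q B)) (Qm (Dsum \<D> A B) B (Pr2 \<D> A B))"

context
  fixes A B assumes obj [simp]: "A \<in> Obj \<D>" "B \<in> Obj \<D>"
begin

lemma dsum_cmp_closed [simp]: "dsum_cmp A B \<in> Mor \<C> (Dsum \<C> (Q A) (Q B)) (Q (Dsum \<D> A B))"
  by (simp add: dsum_cmp_def cat_simps src.cat_simps)

lemma dsum_cmp_inv_closed [simp]:
  "dsum_cmp_inv A B \<in> Mor \<C> (Q (Dsum \<D> A B)) (Dsum \<C> (Q A) (Q B))"
  by (simp add: dsum_cmp_inv_def cat_simps src.cat_simps)

lemma dsum_cmp_In:
  "Comp \<C> (Q A) (Dsum \<C> (Q A) (Q B)) (Q (Dsum \<D> A B)) (dsum_cmp A B) (In1 \<C> (Q A) (Q B))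
    = Qm A (Dsum \<D> A B) (In1 \<D> A B)"
  "Comp \<C> (Q B) (Dsum \<C> (Q A) (Q B)) (Q (Dsum \<D> A B)) (dsum_cmp A B) (In2 \<C> (Q A) (Q B))
    = Qm B (Dsum \<D> A B) (In2 \<D> A B)"
  by (simp_all add: dsum_cmp_def cat_simps src.cat_simps Comp_assoc)

lemma Pr_dsum_cmp_inv:
  "Comp \<C> (Q (Dsum \<D> A B)) (Dsum \<C> (Q A) (Q B)) (Q A) (Pr1 \<C> (Q A) (Q B)) (dsum_cmp_inv A B)
    = Qm (Dsum \<D> A B) A (Pr1 \<D> A B)"
  "Comp \<C> (Q (Dsum \<D> A B)) (Dsum \<C> (Q A) (Q B)) (Q B) (Pr2 \<C> (Q A) (Q B)) (dsum_cmp_inv A B)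
    = Qm (Dsum \<D> A B) B (Pr2 \<D> A B)"
  by (simp_all add: dsum_cmp_inv_def cat_simps src.cat_simps proj_incl_cancel)

lemma Qm_Pr_In:
  "Comp \<C> (Q A) (Q (Dsum \<D> A B)) (Q A) (Qm (Dsum \<D> A B) A (Pr1 \<D> A B))
    (Qm A (Dsum \<D> A B) (In1 \<D> A B)) = Ident \<C> (Q A)"
  "Comp \<C> (Q A) (Q (Dsum \<D> A B)) (Q B) (Qm (Dsum \<D> A B) B (Pr2 \<D> A B))
    (Qm A (Dsum \<D> A B) (In1 \<D> A B)) = \<one>\<^bsub>Hom \<C> (Q A) (Q B)\<^esub>"
  "Comp \<C> (Q B) (Q (Dsum \<D> A B)) (Q A) (Qm (Dsum \<D> A B) A (Pr1 \<D> A B))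
    (Qm B (Dsum \<D> A B) (In2 \<D> A B)) = \<one>\<^bsub>Hom \<C> (Q B) (Q A)\<^esub>"
  "Comp \<C> (Q B) (Q (Dsum \<D> A B)) (Q B) (Qm (Dsum \<D> A B) B (Pr2 \<D> A B))
    (Qm B (Dsum \<D> A B) (In2 \<D> A B)) = Ident \<C> (Q B)"
  by (simp_all add: src.cat_simps Qm_zero Fm_Ident flip: Fm_Comp)

lemma dsum_cmp_inverse:
  "Comp \<C> (Q (Dsum \<D> A B)) (Dsum \<C> (Q A) (Q B)) (Q (Dsum \<D> A B)) (dsum_cmp A B) (dsum_cmp_inv A B)
    = Ident \<C> (Q (Dsum \<D> A B))"
  "Comp \<C> (Dsum \<C> (Q A) (Q B)) (Q (Dsum \<D> A B)) (Dsum \<C> (Q A) (Q B)) (dsum_cmp_inv A B) (dsum_cmp A B)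
    = Ident \<C> (Dsum \<C> (Q A) (Q B))"
proof -
  let ?P = "Dsum \<C> (Q A) (Q B)" and ?R = "Dsum \<D> A B"
  have [simp]: "?P \<in> Obj \<C>" "?R \<in> Obj \<D>" by (simp_all add: cat_simps src.cat_simps)
  note [simp] = src.In1_closed src.In2_closed src.Pr1_closed src.Pr2_closed
  \<comment> \<open>Only \<open>dsum_cmp\<close> is unfolded, so that its projections meet
    \<open>dsum_cmp_inv\<close> and become images of projections. What remains is \<open>Q\<close>
    of in1 pr1 + in2 pr2, the identity.\<close>
  have "Comp \<C> (Q ?R) ?P (Q ?R) (dsum_cmp A B) (dsum_cmp_inv A B) =
      Qm ?R ?R (Comp \<D> ?R A ?R (In1 \<D> A B) (Pr1 \<D> A B)
        \<otimes>\<^bsub>Hom \<D> ?R ?R\<^esub> Comp \<D> ?R B ?R (In2 \<D> A B) (Pr2 \<D> A B))"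
    by (subst dsum_cmp_def)
      (simp add: cat_simps Comp_assoc Pr_dsum_cmp_inv Qm_add Fm_Comp src.cat_simps)
  then show "Comp \<C> (Q ?R) ?P (Q ?R) (dsum_cmp A B) (dsum_cmp_inv A B) = Ident \<C> (Q ?R)"
    by (simp add: src.In_Pr_sum Fm_Ident)
  show "Comp \<C> ?P (Q ?R) ?P (dsum_cmp_inv A B) (dsum_cmp A B) = Ident \<C> ?P"
  proof (rule eq_on_Dsum[of "Q A" "Q B" ?P])
    have "Comp \<C> (Q A) (Q ?R) ?P (dsum_cmp_inv A B) (Qm A ?R (In1 \<D> A B)) = In1 \<C> (Q A) (Q B)"
      by (subst dsum_cmp_inv_def) (simp add: cat_simps Comp_assoc Qm_Pr_In)
    then show "Comp \<C> (Q A) ?P ?P (Comp \<C> ?P (Q ?R) ?P (dsum_cmp_inv A B) (dsum_cmp A B))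
        (In1 \<C> (Q A) (Q B)) = Comp \<C> (Q A) ?P ?P (Ident \<C> ?P) (In1 \<C> (Q A) (Q B))"
      by (simp add: cat_simps Comp_assoc dsum_cmp_In)
    have "Comp \<C> (Q B) (Q ?R) ?P (dsum_cmp_inv A B) (Qm B ?R (In2 \<D> A B)) = In2 \<C> (Q A) (Q B)"
      by (subst dsum_cmp_inv_def) (simp add: cat_simps Comp_assoc Qm_Pr_In)
    then show "Comp \<C> (Q B) ?P ?P (Comp \<C> ?P (Q ?R) ?P (dsum_cmp_inv A B) (dsum_cmp A B))
        (In2 \<C> (Q A) (Q B)) = Comp \<C> (Q B) ?P ?P (Ident \<C> ?P) (In2 \<C> (Q A) (Q B))"
      by (simp add: cat_simps Comp_assoc dsum_cmp_In)
  qed (simp_all add: cat_simps)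
qed

end

lemma dsum_cmp_iso:
  assumes "A \<in> Obj \<D>" "B \<in> Obj \<D>"
  shows "is_iso \<C> (Dsum \<C> (Q A) (Q B)) (Q (Dsum \<D> A B)) (dsum_cmp A B)"
  unfolding is_iso_def using assms dsum_cmp_inverse by (auto intro!: bexI[of _ "dsum_cmp_inv A B"])

text \<open>On each inclusion both sides reduce to \<open>Q\<close> of the component followed by the
  inclusion in \<open>\<D>\<close>.\<close>

lemma dsum_cmp_natural:
  assumes [simp]: "A \<in> Obj \<D>" "B \<in> Obj \<D>" "A' \<in> Obj \<D>" "B' \<in> Obj \<D>"
    "f \<in> Mor \<D> A B" "f' \<in> Mor \<D> A' B'"
  shows "Comp \<C> (Dsum \<C> (Q A) (Q A')) (Dsum \<C> (Q B) (Q B')) (Q (Dsum \<D> B B')) (dsum_cmp B B')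
      (dsum_mor \<C> (Q A) (Q B) (Q A') (Q B') (Qm A B f) (Qm A' B' f'))
    = Comp \<C> (Dsum \<C> (Q A) (Q A')) (Q (Dsum \<D> A A')) (Q (Dsum \<D> B B'))
      (Qm (Dsum \<D> A A') (Dsum \<D> B B') (dsum_mor \<D> A B A' B' f f')) (dsum_cmp A A')"
proof -
  let ?A = "Dsum \<C> (Q A) (Q A')" and ?B = "Dsum \<C> (Q B) (Q B')"
  let ?A' = "Dsum \<D> A A'" and ?B' = "Dsum \<D> B B'"
  let ?F = "dsum_mor \<C> (Q A) (Q B) (Q A') (Q B') (Qm A B f) (Qm A' B' f')"
  have [simp]: "?A \<in> Obj \<C>" "?B \<in> Obj \<C>" "?A' \<in> Obj \<D>" "?B' \<in> Obj \<D>"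
    by (simp_all add: cat_simps src.cat_simps)
  note [simp] = src.In1_closed src.In2_closed dsum_mor_closed src.dsum_mor_closed
    In1_closed In2_closed Comp_closed
  have "Comp \<C> (Q A) ?A (Q ?B') (Comp \<C> ?A ?B (Q ?B') (dsum_cmp B B') ?F) (In1 \<C> (Q A) (Q A')) =
      Comp \<C> (Q A) (Q B) (Q ?B') (Comp \<C> (Q B) ?B (Q ?B') (dsum_cmp B B') (In1 \<C> (Q B) (Q B'))) (Qm A B f)"
    by (simp add: Comp_assoc dsum_mor_In)
  also have "\<dots> = Qm A ?B' (Comp \<D> A ?A' ?B' (dsum_mor \<D> A B A' B' f f') (In1 \<D> A A'))"
    by (simp add: dsum_cmp_In src.dsum_mor_In Fm_Comp)
  also have "\<dots> = Comp \<C> (Q A) ?A (Q ?B') (Comp \<C> ?A (Q ?A') (Q ?B')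
      (Qm ?A' ?B' (dsum_mor \<D> A B A' B' f f')) (dsum_cmp A A')) (In1 \<C> (Q A) (Q A'))"
    by (simp add: Comp_assoc dsum_cmp_In Fm_Comp)
  finally have 1: "Comp \<C> (Q A) ?A (Q ?B') (Comp \<C> ?A ?B (Q ?B') (dsum_cmp B B') ?F) (In1 \<C> (Q A) (Q A')) = \<dots>" .
  have "Comp \<C> (Q A') ?A (Q ?B') (Comp \<C> ?A ?B (Q ?B') (dsum_cmp B B') ?F) (In2 \<C> (Q A) (Q A')) =
      Comp \<C> (Q A') (Q B') (Q ?B') (Comp \<C> (Q B') ?B (Q ?B') (dsum_cmp B B') (In2 \<C> (Q B) (Q B'))) (Qm A' B' f')"
    by (simp add: Comp_assoc dsum_mor_In)
  also have "\<dots> = Qm A' ?B' (Comp \<D> A' ?A' ?B' (dsum_mor \<D> A B A' B' f f') (In2 \<D> A A'))"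
    by (simp add: dsum_cmp_In src.dsum_mor_In Fm_Comp)
  also have "\<dots> = Comp \<C> (Q A') ?A (Q ?B') (Comp \<C> ?A (Q ?A') (Q ?B')
      (Qm ?A' ?B' (dsum_mor \<D> A B A' B' f f')) (dsum_cmp A A')) (In2 \<C> (Q A) (Q A'))"
    by (simp add: Comp_assoc dsum_cmp_In Fm_Comp)
  finally have 2: "Comp \<C> (Q A') ?A (Q ?B') (Comp \<C> ?A ?B (Q ?B') (dsum_cmp B B') ?F) (In2 \<C> (Q A) (Q A')) = \<dots>" .
  show ?thesis
    by (rule eq_on_Dsum[OF _ _ _ _ _ 1 2]) simp_all
qed

text \<open>The ends already agree with those of the split sequence in \<open>\<C>\<close>, so
  moving its middle term along \<open>dsum_cmp\<close> suffices.\<close>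

lemma realised_by_Qm_zero:
  assumes [simp]: "A \<in> Obj \<D>" "C \<in> Obj \<D>"
  shows "realised_by \<C> E s \<one>\<^bsub>Ext E (Q C) (Q A)\<^esub> (Q A) (Q (Dsum \<D> A C)) (Q C)
    (Qm A (Dsum \<D> A C) (In1 \<D> A C)) (Qm (Dsum \<D> A C) C (Pr2 \<D> A C))"
proof (rule realised_by_is_iso[OF _ dsum_cmp_iso[of A C]])
  have "comm_group (Ext E (Q C) (Q A))" by (simp add: Ext_comm_group)
  then have "monoid (Ext E (Q C) (Q A))" by (simp add: comm_group_def group.is_monoid)
  then show "realised_by \<C> E s \<one>\<^bsub>Ext E (Q C) (Q A)\<^esub> (Q A) (Dsum \<C> (Q A) (Q C)) (Q C)
      (In1 \<C> (Q A) (Q C)) (Pr2 \<C> (Q A) (Q C))"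
    by (simp add: realised_by_def sequences_def realise_zero cat_simps monoid.one_closed)
  \<comment> \<open>Q(pr2) is rewritten as pr2 after \<open>dsum_cmp_inv\<close>, which then cancels
    against \<open>dsum_cmp\<close>.\<close>
  have "Comp \<C> (Dsum \<C> (Q A) (Q C)) (Dsum \<C> (Q A) (Q C)) (Q C) (Pr2 \<C> (Q A) (Q C))
      (Comp \<C> (Dsum \<C> (Q A) (Q C)) (Q (Dsum \<D> A C)) (Dsum \<C> (Q A) (Q C))
        (dsum_cmp_inv A C) (dsum_cmp A C)) = Pr2 \<C> (Q A) (Q C)"
    by (simp add: dsum_cmp_inverse cat_simps)
  then show "Comp \<C> (Dsum \<C> (Q A) (Q C)) (Q (Dsum \<D> A C)) (Q C)
      (Qm (Dsum \<D> A C) C (Pr2 \<D> A C)) (dsum_cmp A C) = Pr2 \<C> (Q A) (Q C)"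
    by (simp add: cat_simps src.cat_simps Pr_dsum_cmp_inv flip: Comp_assoc)
qed (simp_all add: src.cat_simps dsum_cmp_In)

text \<open>The sum formed in \<open>\<C>\<close> is moved in two stages: both ends along
  \<open>dsum_cmp\<close> by \<open>realised_by_ext_iso\<close>, then the middle term by
  \<open>realised_by_is_iso\<close>. Naturality of the comparison shows that the resulting maps are
  the images of the sums formed in \<open>\<D>\<close>.\<close>

lemma realised_by_Qm_dsum:
  assumes r: "realised_by \<D> E' s' \<delta> A B C x y" and r': "realised_by \<D> E' s' \<delta>' A' B' C' x' y'"
  shows "realised_by \<D> E' s' (ext_dsum \<D> E' C A \<delta> C' A' \<delta>')
    (Dsum \<D> A A') (Dsum \<D> B B') (Dsum \<D> C C') (dsum_mor \<D> A B A' B' x x') (dsum_mor \<D> B C B' C' y y')"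
proof -
  note R = realised_by_pullbackD[OF r] realised_by_pullbackD[OF r']
  note [simp] = R(1-5) R(7-11) realised_byD[OF R(6)] realised_byD[OF R(12)]
    dsum_mor_closed src.dsum_mor_closed
  let ?A = "Dsum \<C> (Q A) (Q A')" and ?B = "Dsum \<C> (Q B) (Q B')" and ?C = "Dsum \<C> (Q C) (Q C')"
  have [simp]: "?A \<in> Obj \<C>" "?B \<in> Obj \<C>" "?C \<in> Obj \<C>"
    "Dsum \<D> A A' \<in> Obj \<D>" "Dsum \<D> B B' \<in> Obj \<D>" "Dsum \<D> C C' \<in> Obj \<D>"
    by (simp_all add: cat_simps src.cat_simps)
  let ?\<epsilon> = "ext_dsum \<C> E (Q C) (Q A) \<delta> (Q C') (Q A') \<delta>'"
  let ?X = "dsum_mor \<C> (Q A) (Q B) (Q A') (Q B') (Qm A B x) (Qm A' B' x')"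
  let ?Y = "dsum_mor \<C> (Q B) (Q C) (Q B') (Q C') (Qm B C y) (Qm B' C' y')"
  have "?\<epsilon> \<in> carrier (Ext E ?C ?A)"
  proof -
    have "comm_group (Ext E ?C ?A)" by (simp add: Ext_comm_group)
    then have "monoid (Ext E ?C ?A)" by (simp add: comm_group_def group.is_monoid)
    then show ?thesis
      unfolding ext_dsum_def by (intro monoid.m_closed) (simp_all add: ExtMap_closed cat_simps)
  qed
  then have "realised_by \<C> E s ?\<epsilon> ?A ?B ?C ?X ?Y"
    using realise_dsum[OF R(6) R(12)] by (simp add: realised_by_def[of _ _ _ ?\<epsilon>] sequences_def)
  then have "realised_by \<C> E s
      (ExtMap E ?C ?A (Q (Dsum \<D> C C')) (Q (Dsum \<D> A A')) (dsum_cmp_inv C C') (dsum_cmp A A') ?\<epsilon>)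
      (Q (Dsum \<D> A A')) ?B (Q (Dsum \<D> C C'))
      (Comp \<C> (Q (Dsum \<D> A A')) ?A ?B ?X (dsum_cmp_inv A A'))
      (Comp \<C> ?B ?C (Q (Dsum \<D> C C')) (dsum_cmp C C') ?Y)"
    by (rule realised_by_ext_iso) (simp_all add: dsum_cmp_inverse)
  \<comment> \<open>The comparison turns the projections and inclusions of \<open>\<C>\<close> into
    images of those of \<open>\<D>\<close>, so the transported extension equals the sum taken in
    \<open>\<D>\<close>.\<close>
  moreover have "ExtMap E ?C ?A (Q (Dsum \<D> C C')) (Q (Dsum \<D> A A'))
      (dsum_cmp_inv C C') (dsum_cmp A A') ?\<epsilon> = ext_dsum \<D> E' C A \<delta> C' A' \<delta>'"
    by (simp add: ExtMap_ext_dsum Pr_dsum_cmp_inv dsum_cmp_In) (simp add: ext_dsum_def)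
  ultimately have r1: "realised_by \<C> E s (ext_dsum \<D> E' C A \<delta> C' A' \<delta>')
      (Q (Dsum \<D> A A')) ?B (Q (Dsum \<D> C C'))
      (Comp \<C> (Q (Dsum \<D> A A')) ?A ?B ?X (dsum_cmp_inv A A'))
      (Comp \<C> ?B ?C (Q (Dsum \<D> C C')) (dsum_cmp C C') ?Y)" by simp
  have "Comp \<C> (Q (Dsum \<D> A A')) ?B (Q (Dsum \<D> B B')) (dsum_cmp B B')
      (Comp \<C> (Q (Dsum \<D> A A')) ?A ?B ?X (dsum_cmp_inv A A')) =
    Comp \<C> (Q (Dsum \<D> A A')) ?A (Q (Dsum \<D> B B'))
      (Comp \<C> ?A ?B (Q (Dsum \<D> B B')) (dsum_cmp B B') ?X) (dsum_cmp_inv A A')"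
    by (simp add: Comp_assoc)
  also have "\<dots> = Qm (Dsum \<D> A A') (Dsum \<D> B B') (dsum_mor \<D> A B A' B' x x')"
    by (simp add: dsum_cmp_natural Comp_assoc dsum_cmp_inverse cat_simps)
  finally show ?thesis
    by (intro realised_by_pullbackI realised_by_is_iso[OF r1 dsum_cmp_iso[of B B']])
      (simp_all add: dsum_cmp_natural)
qed

lemma additive_realisation_pullback: "additive_realisation \<D> E' s'"
proof (intro additive_realisation.intro realisation_pullback additive_realisation_axioms.intro)
  fix C A assume [simp]: "C \<in> Obj \<D>" "A \<in> Obj \<D>"
  have "realised_by \<D> E' s' \<one>\<^bsub>Ext E' C A\<^esub> A (Dsum \<D> A C) C (In1 \<D> A C) (Pr2 \<D> A C)"
    by (intro realised_by_pullbackI) (simp_all add: src.cat_simps realised_by_Qm_zero)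
  then show "s' C A \<one>\<^bsub>Ext E' C A\<^esub> = seq_class \<D> A (Dsum \<D> A C) C (In1 \<D> A C) (Pr2 \<D> A C)"
    by (simp add: realised_by_def)
next
  fix \<delta> A B C x y \<delta>' A' B' C' x' y'
  assume "realised_by \<D> E' s' \<delta> A B C x y" "realised_by \<D> E' s' \<delta>' A' B' C' x' y'"
  from realised_by_Qm_dsum[OF this]
  show "s' (Dsum \<D> C C') (Dsum \<D> A A') (ext_dsum \<D> E' C A \<delta> C' A' \<delta>') =
      seq_class \<D> (Dsum \<D> A A') (Dsum \<D> B B') (Dsum \<D> C C')
        (dsum_mor \<D> A B A' B' x x') (dsum_mor \<D> B C B' C' y y')"
    by (simp add: realised_by_def)
qed


section \<open>Transfer of (ET3), (ET4) and their duals\<close>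

lemma extriangulated_category_pullback: "extriangulated_category \<D> E' s'"
proof (intro extriangulated_category.intro additive_realisation_pullback
    extriangulated_category_axioms.intro)
  fix \<delta> A B C x y \<delta>' A' B' C' x' y' a b
  assume r: "realised_by \<D> E' s' \<delta> A B C x y" and r': "realised_by \<D> E' s' \<delta>' A' B' C' x' y'"
    and [simp]: "a \<in> Mor \<D> A A'" "b \<in> Mor \<D> B B'"
    and eq: "Comp \<D> A B B' b x = Comp \<D> A A' B' x' a"
  note R = realised_by_pullbackD[OF r] realised_by_pullbackD[OF r']
  note [simp] = R(1-5) R(7-11)
  obtain h where h: "h \<in> Mor \<C> (Q C) (Q C')"
    "ext_morphism \<C> E (Q C) (Q A) \<delta> (Q C') (Q A') \<delta>' (Qm A A' a) h"
    "Comp \<C> (Q B) (Q B') (Q C') (Qm B' C' y') (Qm B B' b) = Comp \<C> (Q B) (Q C) (Q C') h (Qm B C y)"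
    using ET3[OF R(6) R(12), of "Qm A A' a" "Qm B B' b"] eq by (auto simp: Comp_eq_Comp_iff)
  \<comment> \<open>The solution found in \<open>\<C>\<close> lies between images of objects of
    \<open>\<D>\<close>, so fullness lifts it and faithfulness lifts its equations.\<close>
  obtain c where c [simp]: "c \<in> Mor \<D> C C'" and "h = Qm C C' c"
    by (rule Qm_surj[OF _ _ h(1)]) auto
  with h show "\<exists>c\<in>Mor \<D> C C'. ext_morphism \<D> E' C A \<delta> C' A' \<delta>' a c \<and>
      Comp \<D> B B' C' y' b = Comp \<D> B C C' c y"
    by (intro bexI[OF _ c]) (simp add: ext_morphism_pullback_iff Comp_eq_Comp_iff)
next
  fix \<delta> A B C x y \<delta>' A' B' C' x' y' b c
  assume r: "realised_by \<D> E' s' \<delta> A B C x y" and r': "realised_by \<D> E' s' \<delta>' A' B' C' x' y'"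
    and [simp]: "b \<in> Mor \<D> B B'" "c \<in> Mor \<D> C C'"
    and eq: "Comp \<D> B C C' c y = Comp \<D> B B' C' y' b"
  note R = realised_by_pullbackD[OF r] realised_by_pullbackD[OF r']
  note [simp] = R(1-5) R(7-11)
  obtain h where h: "h \<in> Mor \<C> (Q A) (Q A')"
    "ext_morphism \<C> E (Q C) (Q A) \<delta> (Q C') (Q A') \<delta>' h (Qm C C' c)"
    "Comp \<C> (Q A) (Q B) (Q B') (Qm B B' b) (Qm A B x) = Comp \<C> (Q A) (Q A') (Q B') (Qm A' B' x') h"
    using ET3_op[OF R(6) R(12), of "Qm B B' b" "Qm C C' c"] eq by (auto simp: Comp_eq_Comp_iff)
  obtain a where a [simp]: "a \<in> Mor \<D> A A'" and "h = Qm A A' a"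
    by (rule Qm_surj[OF _ _ h(1)]) auto
  with h show "\<exists>a\<in>Mor \<D> A A'. ext_morphism \<D> E' C A \<delta> C' A' \<delta>' a c \<and>
      Comp \<D> A B B' b x = Comp \<D> A A' B' x' a"
    by (intro bexI[OF _ a]) (simp add: ext_morphism_pullback_iff Comp_eq_Comp_iff)
next
  fix \<delta> A B D f f' \<delta>' C F g g'
  assume r: "realised_by \<D> E' s' \<delta> A B D f f'" and r': "realised_by \<D> E' s' \<delta>' B C F g g'"
  note R = realised_by_pullbackD[OF r] realised_by_pullbackD[OF r']
  note [simp] = R(1-5) R(8-11)
  from ET4[OF R(6) R(12)] obtain G\<^sub>0 h\<^sub>0 h\<^sub>0' d\<^sub>0 e\<^sub>0 \<delta>'' where G0: "G\<^sub>0 \<in> Obj \<C>"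
    and m: "h\<^sub>0 \<in> Mor \<C> (Q A) (Q C)" "h\<^sub>0' \<in> Mor \<C> (Q C) G\<^sub>0" "d\<^sub>0 \<in> Mor \<C> (Q D) G\<^sub>0" "e\<^sub>0 \<in> Mor \<C> G\<^sub>0 (Q F)"
    and eq: "h\<^sub>0 = Comp \<C> (Q A) (Q B) (Q C) (Qm B C g) (Qm A B f)"
      "Comp \<C> (Q B) (Q C) G\<^sub>0 h\<^sub>0' (Qm B C g) = Comp \<C> (Q B) (Q D) G\<^sub>0 d\<^sub>0 (Qm B D f')"
      "Comp \<C> (Q C) G\<^sub>0 (Q F) e\<^sub>0 h\<^sub>0' = Qm C F g'"
    and \<delta>'': "\<delta>'' \<in> carrier (Ext E G\<^sub>0 (Q A))"
      "realised_by \<C> E s \<delta>'' (Q A) (Q C) G\<^sub>0 h\<^sub>0 h\<^sub>0'"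
      "realised_by \<C> E s (push \<C> E (Q F) (Q B) (Q D) (Qm B D f') \<delta>') (Q D) G\<^sub>0 (Q F) d\<^sub>0 e\<^sub>0"
      "pull \<C> E G\<^sub>0 (Q A) (Q D) d\<^sub>0 \<delta>'' = \<delta>"
      "push \<C> E G\<^sub>0 (Q A) (Q B) (Qm A B f) \<delta>'' = pull \<C> E (Q F) (Q B) G\<^sub>0 e\<^sub>0 \<delta>'"
    by blast
  \<comment> \<open>\<open>G\<^sub>0\<close> is the one object produced by (ET4) itself; replacing
    it by some Q G lets the remaining maps be lifted by fullness.\<close>
  obtain G where G [simp]: "G \<in> Obj \<D>" and [simp]: "G\<^sub>0 = Q G" using G0 by (rule Q_surj)
  note m' = m[unfolded \<open>G\<^sub>0 = Q G\<close>]
  obtain h' where h' [simp]: "h' \<in> Mor \<D> C G" and [simp]: "h\<^sub>0' = Qm C G h'"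
    by (rule Qm_surj[OF _ _ m'(2)]) auto
  obtain d where d [simp]: "d \<in> Mor \<D> D G" and [simp]: "d\<^sub>0 = Qm D G d"
    by (rule Qm_surj[OF _ _ m'(3)]) auto
  obtain e where e [simp]: "e \<in> Mor \<D> G F" and [simp]: "e\<^sub>0 = Qm G F e"
    by (rule Qm_surj[OF _ _ m'(4)]) auto
  \<comment> \<open>(ET4) prescribes this composite, so it is formed in \<open>\<D>\<close> and its
    image is \<open>h\<^sub>0\<close> by functoriality.\<close>
  define h where "h = Comp \<D> A B C g f"
  have h [simp]: "h \<in> Mor \<D> A C" by (simp add: h_def src.cat_simps)
  have [simp]: "h\<^sub>0 = Qm A C h" by (simp add: h_def eq Fm_Comp)
  show "\<exists>G\<in>Obj \<D>. \<exists>h\<in>Mor \<D> A C. \<exists>h'\<in>Mor \<D> C G. \<exists>d\<in>Mor \<D> D G. \<exists>e\<in>Mor \<D> G F.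
      h = Comp \<D> A B C g f \<and> Comp \<D> B C G h' g = Comp \<D> B D G d f' \<and> Comp \<D> C G F e h' = g' \<and>
      (\<exists>\<delta>''\<in>carrier (Ext E' G A). realised_by \<D> E' s' \<delta>'' A C G h h' \<and>
        realised_by \<D> E' s' (push \<D> E' F B D f' \<delta>') D G F d e \<and>
        pull \<D> E' G A D d \<delta>'' = \<delta> \<and> push \<D> E' G A B f \<delta>'' = pull \<D> E' F B G e \<delta>')"
    using eq \<delta>''
    by (intro bexI[OF _ G] bexI[OF _ h] bexI[OF _ h'] bexI[OF _ d] bexI[OF _ e] conjI bexI[of _ \<delta>''])
      (simp_all add: h_def Comp_eq_iff Comp_eq_Comp_iff realised_by_pullbackI src.cat_simps)
next
  fix \<delta> D A B f' f \<delta>' F C g' g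
  assume r: "realised_by \<D> E' s' \<delta> D A B f' f" and r': "realised_by \<D> E' s' \<delta>' F B C g' g"
  note R = realised_by_pullbackD[OF r] realised_by_pullbackD[OF r']
  note [simp] = R(1-5) R(7) R(9-11)
  from ET4_op[OF R(6) R(12)] obtain G\<^sub>0 d\<^sub>0 e\<^sub>0 h\<^sub>0' h\<^sub>0 \<delta>'' where G0: "G\<^sub>0 \<in> Obj \<C>"
    and m: "h\<^sub>0 \<in> Mor \<C> (Q A) (Q C)" "h\<^sub>0' \<in> Mor \<C> G\<^sub>0 (Q A)" "d\<^sub>0 \<in> Mor \<C> (Q D) G\<^sub>0" "e\<^sub>0 \<in> Mor \<C> G\<^sub>0 (Q F)"
    and eq: "h\<^sub>0 = Comp \<C> (Q A) (Q B) (Q C) (Qm B C g) (Qm A B f)"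
      "Comp \<C> (Q D) G\<^sub>0 (Q A) h\<^sub>0' d\<^sub>0 = Qm D A f'"
      "Comp \<C> G\<^sub>0 (Q A) (Q B) (Qm A B f) h\<^sub>0' = Comp \<C> G\<^sub>0 (Q F) (Q B) (Qm F B g') e\<^sub>0"
    and \<delta>'': "\<delta>'' \<in> carrier (Ext E (Q C) G\<^sub>0)"
      "realised_by \<C> E s \<delta>'' G\<^sub>0 (Q A) (Q C) h\<^sub>0' h\<^sub>0"
      "realised_by \<C> E s (pull \<C> E (Q B) (Q D) (Q F) (Qm F B g') \<delta>) (Q D) G\<^sub>0 (Q F) d\<^sub>0 e\<^sub>0"
      "push \<C> E (Q C) G\<^sub>0 (Q F) e\<^sub>0 \<delta>'' = \<delta>'"
      "push \<C> E (Q B) (Q D) G\<^sub>0 d\<^sub>0 \<delta> = pull \<C> E (Q C) G\<^sub>0 (Q B) (Qm B C g) \<delta>''"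
    by blast
  obtain G where G [simp]: "G \<in> Obj \<D>" and [simp]: "G\<^sub>0 = Q G" using G0 by (rule Q_surj)
  note m' = m[unfolded \<open>G\<^sub>0 = Q G\<close>]
  obtain h' where h' [simp]: "h' \<in> Mor \<D> G A" and [simp]: "h\<^sub>0' = Qm G A h'"
    by (rule Qm_surj[OF _ _ m'(2)]) auto
  obtain d where d [simp]: "d \<in> Mor \<D> D G" and [simp]: "d\<^sub>0 = Qm D G d"
    by (rule Qm_surj[OF _ _ m'(3)]) auto
  obtain e where e [simp]: "e \<in> Mor \<D> G F" and [simp]: "e\<^sub>0 = Qm G F e"
    by (rule Qm_surj[OF _ _ m'(4)]) auto
  define h where "h = Comp \<D> A B C g f"
  have h [simp]: "h \<in> Mor \<D> A C" by (simp add: h_def src.cat_simps)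
  have [simp]: "h\<^sub>0 = Qm A C h" by (simp add: h_def eq Fm_Comp)
  show "\<exists>G\<in>Obj \<D>. \<exists>d\<in>Mor \<D> D G. \<exists>e\<in>Mor \<D> G F. \<exists>h'\<in>Mor \<D> G A. \<exists>h\<in>Mor \<D> A C.
      h = Comp \<D> A B C g f \<and> Comp \<D> D G A h' d = f' \<and> Comp \<D> G A B f h' = Comp \<D> G F B g' e \<and>
      (\<exists>\<delta>''\<in>carrier (Ext E' C G). realised_by \<D> E' s' \<delta>'' G A C h' h \<and>
        realised_by \<D> E' s' (pull \<D> E' B D F g' \<delta>) D G F d e \<and>
        push \<D> E' C G F e \<delta>'' = \<delta>' \<and> push \<D> E' B D G d \<delta> = pull \<D> E' C G B g \<delta>'')"
    using eq \<delta>''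
    by (intro bexI[OF _ G] bexI[OF _ d] bexI[OF _ e] bexI[OF _ h'] bexI[OF _ h] conjI bexI[of _ \<delta>''])
      (simp_all add: h_def Comp_eq_iff Comp_eq_Comp_iff realised_by_pullbackI src.cat_simps)
qed

end

section \<open>The weak idempotent completion\<close>

text \<open>\<open>wic\<close> matches on pairs; stated with \<open>fst\<close> and
  \<open>snd\<close>, its components also rewrite at an object that is only a variable.\<close>

lemma wic_simps:
  "P \<in> Obj (wic \<C>) \<longleftrightarrow> fst P \<in> Obj \<C> \<and> split_idempotent \<C> (fst P) (snd P)"
  "f \<in> Mor (wic \<C>) P R \<longleftrightarrow> f \<in> Mor \<C> (fst P) (fst R) \<and>
    Comp \<C> (fst P) (fst P) (fst R) f (snd P) = f \<and> Comp \<C> (fst P) (fst R) (fst R) (snd R) f = f"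
  "f \<otimes>\<^bsub>Hom (wic \<C>) P R\<^esub> g = f \<otimes>\<^bsub>Hom \<C> (fst P) (fst R)\<^esub> g"
  "\<one>\<^bsub>Hom (wic \<C>) P R\<^esub> = \<one>\<^bsub>Hom \<C> (fst P) (fst R)\<^esub>"
  "Comp (wic \<C>) P R S = Comp \<C> (fst P) (fst R) (fst S)"
  "Ident (wic \<C>) P = snd P"
  "Dsum (wic \<C>) P R = (Dsum \<C> (fst P) (fst R), dsum_mor \<C> (fst P) (fst P) (fst R) (fst R) (snd P) (snd R))"
  "In1 (wic \<C>) P R = Comp \<C> (fst P) (fst P) (Dsum \<C> (fst P) (fst R)) (In1 \<C> (fst P) (fst R)) (snd P)"
  "In2 (wic \<C>) P R = Comp \<C> (fst R) (fst R) (Dsum \<C> (fst P) (fst R)) (In2 \<C> (fst P) (fst R)) (snd R)"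
  "Pr1 (wic \<C>) P R = Comp \<C> (Dsum \<C> (fst P) (fst R)) (fst P) (fst P) (snd P) (Pr1 \<C> (fst P) (fst R))"
  "Pr2 (wic \<C>) P R = Comp \<C> (Dsum \<C> (fst P) (fst R)) (fst R) (fst R) (snd R) (Pr2 \<C> (fst P) (fst R))"
  by (cases P; cases R; cases S; simp add: wic_def)+

definition splits_as :: "('o, 'm) add_cat \<Rightarrow> 'o \<times> 'm \<Rightarrow> 'o \<Rightarrow> 'm \<Rightarrow> 'm \<Rightarrow> bool"
  where "splits_as \<C> P X r c \<longleftrightarrow> X \<in> Obj \<C> \<and> r \<in> Mor \<C> (fst P) X \<and> c \<in> Mor \<C> X (fst P) \<and>
    Comp \<C> (fst P) X (fst P) c r = snd P \<and> Comp \<C> X (fst P) X r c = Ident \<C> X"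

text \<open>Identities are split trivially, so that the functor from the completion to \<open>\<C>\<close> defined by
  these choices is a strict left inverse of the embedding.\<close>

definition wic_splitting :: "('o, 'm) add_cat \<Rightarrow> 'o \<times> 'm \<Rightarrow> 'o \<times> 'm \<times> 'm"
  where "wic_splitting \<C> P = (if snd P = Ident \<C> (fst P) then (fst P, snd P, snd P)
    else (SOME (X, r, c). splits_as \<C> P X r c))"

definition wic_image :: "('o, 'm) add_cat \<Rightarrow> 'o \<times> 'm \<Rightarrow> 'o"
  where "wic_image \<C> P = fst (wic_splitting \<C> P)"

definition wic_retr :: "('o, 'm) add_cat \<Rightarrow> 'o \<times> 'm \<Rightarrow> 'm"
  where "wic_retr \<C> P = fst (snd (wic_splitting \<C> P))"

definition wic_sect :: "('o, 'm) add_cat \<Rightarrow> 'o \<times> 'm \<Rightarrow> 'm"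
  where "wic_sect \<C> P = snd (snd (wic_splitting \<C> P))"

definition wic_image_mor :: "('o, 'm) add_cat \<Rightarrow> 'o \<times> 'm \<Rightarrow> 'o \<times> 'm \<Rightarrow> 'm \<Rightarrow> 'm"
  where "wic_image_mor \<C> P R f =
    Comp \<C> (wic_image \<C> P) (fst R) (wic_image \<C> R) (wic_retr \<C> R)
      (Comp \<C> (wic_image \<C> P) (fst P) (fst R) f (wic_sect \<C> P))"

context additive_category
begin

section \<open>Split idempotents and the additive structure of the completion\<close>

lemma split_idempotentD:
  assumes "split_idempotent \<C> A p"
  shows "p \<in> Mor \<C> A A" "Comp \<C> A A A p p = p"
  using assms by (auto simp: split_idempotent_def)

lemma split_idempotent_absorb:
  assumes "split_idempotent \<C> A p" "A \<in> Obj \<C>" "K \<in> Obj \<C>"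
  shows "f \<in> Mor \<C> K A \<Longrightarrow> Comp \<C> K A A p (Comp \<C> K A A p f) = Comp \<C> K A A p f"
  using assms by (simp add: split_idempotentD flip: Comp_assoc)

lemma split_idempotent_Ident: "A \<in> Obj \<C> \<Longrightarrow> split_idempotent \<C> A (Ident \<C> A)"
  unfolding split_idempotent_def by (auto simp: cat_simps intro!: bexI[of _ A] bexI[of _ "Ident \<C> A"])

text \<open>If p splits through X and q through Y, then p (+) q splits through X (+) Y by the sums
  of the retractions and of the sections.\<close>

lemma split_idempotent_dsum:
  assumes [simp]: "A \<in> Obj \<C>" "B \<in> Obj \<C>"
    and p: "split_idempotent \<C> A p" and q: "split_idempotent \<C> B q"
  shows "split_idempotent \<C> (Dsum \<C> A B) (dsum_mor \<C> A A B B p q)"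
proof -
  note [simp] = split_idempotentD[OF p] split_idempotentD[OF q]
  obtain X r c where 1 [simp]: "X \<in> Obj \<C>" "r \<in> Mor \<C> A X" "c \<in> Mor \<C> X A"
    "Comp \<C> A X A c r = p" "Comp \<C> X A X r c = Ident \<C> X"
    using p by (auto simp: split_idempotent_def)
  obtain Y r' c' where 2 [simp]: "Y \<in> Obj \<C>" "r' \<in> Mor \<C> B Y" "c' \<in> Mor \<C> Y B"
    "Comp \<C> B Y B c' r' = q" "Comp \<C> Y B Y r' c' = Ident \<C> Y"
    using q by (auto simp: split_idempotent_def)
  show ?thesis
    unfolding split_idempotent_def
    by (intro conjI bexI[of _ "Dsum \<C> X Y"] bexI[of _ "dsum_mor \<C> A X B Y r r'"]
        bexI[of _ "dsum_mor \<C> X A Y B c c'"])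
      (simp_all add: dsum_mor_closed dsum_mor_comp dsum_mor_Ident cat_simps)
qed

lemma Hom_wic_comm_group:
  assumes "P \<in> Obj (wic \<C>)" "R \<in> Obj (wic \<C>)"
  shows "comm_group (Hom (wic \<C>) P R)"
proof -
  have [simp]: "fst P \<in> Obj \<C>" "fst R \<in> Obj \<C>" using assms by (simp_all add: wic_simps)
  have [simp]: "snd P \<in> Mor \<C> (fst P) (fst P)" "snd R \<in> Mor \<C> (fst R) (fst R)"
    using assms by (simp_all add: wic_simps split_idempotentD)
  interpret H: comm_group "Hom \<C> (fst P) (fst R)" by (simp add: Hom_comm_group)
  show ?thesis
  proof (rule comm_groupI)
    fix f assume f: "f \<in> Mor (wic \<C>) P R"
    then have [simp]: "f \<in> Mor \<C> (fst P) (fst R)" by (simp add: wic_simps)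
    \<comment> \<open>The absorption conditions are additive in \<open>f\<close>, so the negative
      taken in \<open>\<C>\<close> satisfies them too.\<close>
    have "inv\<^bsub>Hom \<C> (fst P) (fst R)\<^esub> f \<in> Mor (wic \<C>) P R"
      using f by (simp add: wic_simps Comp_inv_left Comp_inv_right)
    then show "\<exists>g\<in>Mor (wic \<C>) P R. g \<otimes>\<^bsub>Hom (wic \<C>) P R\<^esub> f = \<one>\<^bsub>Hom (wic \<C>) P R\<^esub>"
      by (rule bexI[rotated]) (simp add: wic_simps)
  qed (simp_all add: wic_simps cat_simps H.m_ac)
qed

text \<open>The identity of (A, p) is p, so the absorption conditions on morphisms are precisely the
  identity laws. The inclusions and projections are those of \<open>\<C>\<close> cut down by the
  idempotents; since p p = p and q q = q, the sum of their composites is p (+) q, the identity of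
  the direct sum.\<close>

lemma additive_category_wic: "additive_category (wic \<C>)"
proof (rule additive_category.intro, goal_cases)
  case 6 then show ?case by (rule Hom_wic_comm_group)
next
  case 9
  \<comment> \<open>A zero object of \<open>\<C>\<close> with its identity serves again: the
    hom-sets of the completion are subsets of those of \<open>\<C>\<close> and contain the zero
    map.\<close>
  obtain Z where Z: "Z \<in> Obj \<C>"
    and uniq: "\<forall>A\<in>Obj \<C>. (\<exists>!f. f \<in> Mor \<C> Z A) \<and> (\<exists>!f. f \<in> Mor \<C> A Z)"
    using zero_object by (elim bexE)
  have "(\<exists>!f. f \<in> Mor (wic \<C>) (Z, Ident \<C> Z) P) \<and> (\<exists>!f. f \<in> Mor (wic \<C>) P (Z, Ident \<C> Z))"
    if P: "P \<in> Obj (wic \<C>)" for P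
  proof -
    have "fst P \<in> Obj \<C>" "snd P \<in> Mor \<C> (fst P) (fst P)"
      using P by (simp_all add: wic_simps split_idempotentD)
    with Z have "\<one>\<^bsub>Hom \<C> Z (fst P)\<^esub> \<in> Mor (wic \<C>) (Z, Ident \<C> Z) P"
      "\<one>\<^bsub>Hom \<C> (fst P) Z\<^esub> \<in> Mor (wic \<C>) P (Z, Ident \<C> Z)"
      by (simp_all add: wic_simps cat_simps)
    moreover have "f = g" if "f \<in> Mor (wic \<C>) (Z, Ident \<C> Z) P" "g \<in> Mor (wic \<C>) (Z, Ident \<C> Z) P" for f g
      using that bspec[OF uniq \<open>fst P \<in> Obj \<C>\<close>] by (auto simp: wic_simps)
    moreover have "f = g" if "f \<in> Mor (wic \<C>) P (Z, Ident \<C> Z)" "g \<in> Mor (wic \<C>) P (Z, Ident \<C> Z)" for f g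
      using that bspec[OF uniq \<open>fst P \<in> Obj \<C>\<close>] by (auto simp: wic_simps)
    ultimately show ?thesis by blast
  qed
  with Z show ?case
    by (intro bexI[of _ "(Z, Ident \<C> Z)"]) (auto simp: wic_simps(1) split_idempotent_Ident)
next
  case (2 P R S f g)
  then have "Comp \<C> (fst P) (fst S) (fst S) (snd S) (Comp \<C> (fst P) (fst R) (fst S) g f)
      = Comp \<C> (fst P) (fst R) (fst S) g f"
    by (simp add: wic_simps split_idempotentD flip: Comp_assoc)
  with 2 show ?case by (simp add: wic_simps split_idempotentD cat_simps Comp_assoc)
next
  case 10 then show ?case by (simp add: wic_simps cat_simps split_idempotent_dsum)
qed (simp_all add: wic_simps split_idempotentD split_idempotent_absorb cat_simps Comp_assoc
    proj_incl_cancel dsum_mor_def)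


section \<open>The functor taking a split idempotent to its image\<close>

lemma wic_splits_as:
  assumes P: "P \<in> Obj (wic \<C>)"
  shows "splits_as \<C> P (wic_image \<C> P) (wic_retr \<C> P) (wic_sect \<C> P)"
proof -
  have "case wic_splitting \<C> P of (X, r, c) \<Rightarrow> splits_as \<C> P X r c"
  proof (cases "snd P = Ident \<C> (fst P)")
    case True
    with P show ?thesis by (simp add: wic_splitting_def splits_as_def wic_simps cat_simps)
  next
    case False
    have "\<exists>t. case t of (X, r, c) \<Rightarrow> splits_as \<C> P X r c"
      using P by (fastforce simp: wic_simps split_idempotent_def splits_as_def)
    with False show ?thesis unfolding wic_splitting_def by (simp only: if_False someI_ex)
  qed
  then show ?thesis by (simp add: wic_image_def wic_retr_def wic_sect_def case_prod_unfold)
qed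

lemma wic_image_Ident:
  "wic_image \<C> (A, Ident \<C> A) = A" "wic_retr \<C> (A, Ident \<C> A) = Ident \<C> A"
  "wic_sect \<C> (A, Ident \<C> A) = Ident \<C> A"
  by (simp_all add: wic_image_def wic_retr_def wic_sect_def wic_splitting_def)

lemma wic_splits:
  assumes "P \<in> Obj (wic \<C>)"
  shows "fst P \<in> Obj \<C>" "wic_image \<C> P \<in> Obj \<C>"
    "wic_retr \<C> P \<in> Mor \<C> (fst P) (wic_image \<C> P)" "wic_sect \<C> P \<in> Mor \<C> (wic_image \<C> P) (fst P)"
    "Comp \<C> (fst P) (wic_image \<C> P) (fst P) (wic_sect \<C> P) (wic_retr \<C> P) = snd P"
    "Comp \<C> (wic_image \<C> P) (fst P) (wic_image \<C> P) (wic_retr \<C> P) (wic_sect \<C> P) = Ident \<C> (wic_image \<C> P)"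
  using wic_splits_as[OF assms] assms by (simp_all add: splits_as_def wic_simps)

text \<open>r p = r c r = r and p c = c r c = c.\<close>

lemma wic_splits_absorb:
  assumes "P \<in> Obj (wic \<C>)"
  shows "Comp \<C> (fst P) (fst P) (wic_image \<C> P) (wic_retr \<C> P) (snd P) = wic_retr \<C> P"
    and "Comp \<C> (wic_image \<C> P) (fst P) (fst P) (snd P) (wic_sect \<C> P) = wic_sect \<C> P"
proof -
  note S = wic_splits[OF assms]
  have "Comp \<C> (fst P) (fst P) (wic_image \<C> P) (wic_retr \<C> P)
      (Comp \<C> (fst P) (wic_image \<C> P) (fst P) (wic_sect \<C> P) (wic_retr \<C> P)) = wic_retr \<C> P"
    by (simp add: S(1-4) S(6) Comp_Ident_left flip: Comp_assoc)
  then show "Comp \<C> (fst P) (fst P) (wic_image \<C> P) (wic_retr \<C> P) (snd P) = wic_retr \<C> P"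
    by (simp only: S(5))
  have "Comp \<C> (wic_image \<C> P) (fst P) (fst P)
      (Comp \<C> (fst P) (wic_image \<C> P) (fst P) (wic_sect \<C> P) (wic_retr \<C> P)) (wic_sect \<C> P)
    = wic_sect \<C> P"
    by (simp add: S(1-4) S(6) Comp_Ident_right Comp_assoc)
  then show "Comp \<C> (wic_image \<C> P) (fst P) (fst P) (snd P) (wic_sect \<C> P) = wic_sect \<C> P"
    by (simp only: S(5))
qed

lemma additive_functor_wic_image: "additive_functor (wic \<C>) \<C> (wic_image \<C>) (wic_image_mor \<C>)"
proof (intro additive_functor.intro additive_category_wic additive_category_axioms
    additive_functor_axioms.intro)
  show "wic_image \<C> P \<in> Obj \<C>" if "P \<in> Obj (wic \<C>)" for P using wic_splits[OF that] by simp
  show "wic_image_mor \<C> P R \<in> hom (Hom (wic \<C>) P R) (Hom \<C> (wic_image \<C> P) (wic_image \<C> R))"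
    if "P \<in> Obj (wic \<C>)" "R \<in> Obj (wic \<C>)" for P R
    using wic_splits[OF that(1)] wic_splits[OF that(2)]
    by (intro homI) (simp_all add: wic_image_mor_def wic_simps cat_simps)
  show "wic_image_mor \<C> P P (Ident (wic \<C>) P) = Ident \<C> (wic_image \<C> P)"
    if "P \<in> Obj (wic \<C>)" for P
    using that wic_splits[OF that] wic_splits_absorb[OF that] by (simp add: wic_image_mor_def wic_simps)
  show "wic_image_mor \<C> P T (Comp (wic \<C>) P R T g f) =
      Comp \<C> (wic_image \<C> P) (wic_image \<C> R) (wic_image \<C> T) (wic_image_mor \<C> R T g) (wic_image_mor \<C> P R f)"
    if obj: "P \<in> Obj (wic \<C>)" "R \<in> Obj (wic \<C>)" "T \<in> Obj (wic \<C>)"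
      and f: "f \<in> Mor (wic \<C>) P R" and g: "g \<in> Mor (wic \<C>) R T" for P R T f g
  proof -
    note [simp] = wic_splits[OF obj(1)] wic_splits[OF obj(2)] wic_splits[OF obj(3)]
    have [simp]: "f \<in> Mor \<C> (fst P) (fst R)" "g \<in> Mor \<C> (fst R) (fst T)"
      "Comp \<C> (fst P) (fst R) (fst R) (snd R) f = f"
      using f g by (simp_all add: wic_simps)
    have [simp]: "snd R \<in> Mor \<C> (fst R) (fst R)" using obj by (simp add: wic_simps split_idempotentD)
    \<comment> \<open>Between the two factors of the image composite stands c r for
      \<open>R\<close>; this is the idempotent of \<open>R\<close>, which \<open>f\<close>
      absorbs.\<close>
    have "Comp \<C> (wic_image \<C> P) (wic_image \<C> R) (fst R) (wic_sect \<C> R)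
        (Comp \<C> (wic_image \<C> P) (fst R) (wic_image \<C> R) (wic_retr \<C> R)
          (Comp \<C> (wic_image \<C> P) (fst P) (fst R) f (wic_sect \<C> P))) =
      Comp \<C> (wic_image \<C> P) (fst P) (fst R) f (wic_sect \<C> P)"
      by (simp add: cat_simps flip: Comp_assoc)
    then show ?thesis by (simp add: wic_image_mor_def wic_simps cat_simps Comp_assoc)
  qed
qed

text \<open>The inverse sends \<open>f\<close> to c f r, a morphism of the completion since r
  absorbs the idempotent of \<open>P\<close> and c that of \<open>R\<close>. One round trip is c r f
  c r = f by the absorption conditions, the other is r c f r c = f by r c = 1.\<close>

lemma wic_image_fully_faithful:
  assumes obj: "P \<in> Obj (wic \<C>)" "R \<in> Obj (wic \<C>)"
  shows "bij_betw (wic_image_mor \<C> P R) (Mor (wic \<C>) P R) (Mor \<C> (wic_image \<C> P) (wic_image \<C> R))"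
proof -
  note P [simp] = wic_splits[OF obj(1)] and R [simp] = wic_splits[OF obj(2)]
  have [simp]: "snd P \<in> Mor \<C> (fst P) (fst P)" "snd R \<in> Mor \<C> (fst R) (fst R)"
    using obj by (simp_all add: wic_simps split_idempotentD)
  let ?g = "\<lambda>f. Comp \<C> (fst P) (wic_image \<C> R) (fst R) (wic_sect \<C> R)
    (Comp \<C> (fst P) (wic_image \<C> P) (wic_image \<C> R) f (wic_retr \<C> P))"
  note retr = wic_splits_absorb(1)[OF obj(1)] and sect = wic_splits_absorb(2)[OF obj(2)]
  show ?thesis
  proof (rule bij_betwI[of _ _ _ ?g])
    show "wic_image_mor \<C> P R \<in> Mor (wic \<C>) P R \<rightarrow> Mor \<C> (wic_image \<C> P) (wic_image \<C> R)"
      by (auto simp: wic_image_mor_def wic_simps cat_simps)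
    show "?g \<in> Mor \<C> (wic_image \<C> P) (wic_image \<C> R) \<rightarrow> Mor (wic \<C>) P R"
    proof
      fix f assume [simp]: "f \<in> Mor \<C> (wic_image \<C> P) (wic_image \<C> R)"
      have "Comp \<C> (fst P) (fst P) (fst R) (?g f) (snd P) = ?g f"
        by (simp add: Comp_assoc cat_simps retr)
      moreover have "Comp \<C> (fst P) (fst R) (fst R) (snd R) (?g f) = ?g f"
        by (subst Comp_assoc[symmetric]) (simp_all add: cat_simps sect)
      ultimately show "?g f \<in> Mor (wic \<C>) P R" by (simp add: wic_simps cat_simps)
    qed
    show "?g (wic_image_mor \<C> P R f) = f" if "f \<in> Mor (wic \<C>) P R" for f
    proof -
      have f [simp]: "f \<in> Mor \<C> (fst P) (fst R)" "Comp \<C> (fst P) (fst P) (fst R) f (snd P) = f"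
        "Comp \<C> (fst P) (fst R) (fst R) (snd R) f = f"
        using that by (simp_all add: wic_simps)
      have "?g (wic_image_mor \<C> P R f) = Comp \<C> (fst P) (wic_image \<C> R) (fst R) (wic_sect \<C> R)
          (Comp \<C> (fst P) (fst R) (wic_image \<C> R) (wic_retr \<C> R) f)"
        by (simp add: wic_image_mor_def Comp_assoc cat_simps)
      also have "\<dots> = f" by (simp flip: Comp_assoc)
      finally show ?thesis .
    qed
    show "wic_image_mor \<C> P R (?g f) = f" if [simp]: "f \<in> Mor \<C> (wic_image \<C> P) (wic_image \<C> R)" for f
    proof -
      have "wic_image_mor \<C> P R (?g f) =
          Comp \<C> (wic_image \<C> P) (fst R) (wic_image \<C> R) (wic_retr \<C> R)
            (Comp \<C> (wic_image \<C> P) (wic_image \<C> R) (fst R) (wic_sect \<C> R) f)"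
        by (simp add: wic_image_mor_def Comp_assoc cat_simps)
      also have "\<dots> = f" by (simp add: cat_simps flip: Comp_assoc)
      finally show ?thesis .
    qed
  qed
qed

section \<open>The embedding and its strict left inverse\<close>

lemma wic_embed_obj_closed: "A \<in> Obj \<C> \<Longrightarrow> wic_embed_obj \<C> A \<in> Obj (wic \<C>)"
  by (simp add: wic_embed_obj_def wic_simps split_idempotent_Ident)

lemma wic_image_embed: "wic_image \<C> (wic_embed_obj \<C> A) = A"
  by (simp add: wic_embed_obj_def wic_image_Ident)

text \<open>For identity idempotents the absorption conditions are the unit laws.\<close>

lemma Mor_wic_embed:
  "\<lbrakk>A \<in> Obj \<C>; B \<in> Obj \<C>\<rbrakk> \<Longrightarrow> Mor (wic \<C>) (wic_embed_obj \<C> A) (wic_embed_obj \<C> B) = Mor \<C> A B"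
  by (auto simp: wic_simps wic_embed_obj_def cat_simps)

lemma wic_image_mor_embed:
  "\<lbrakk>A \<in> Obj \<C>; B \<in> Obj \<C>; f \<in> Mor \<C> A B\<rbrakk>
    \<Longrightarrow> wic_image_mor \<C> (wic_embed_obj \<C> A) (wic_embed_obj \<C> B) f = f"
  by (simp add: wic_image_mor_def wic_embed_obj_def wic_image_Ident cat_simps)

lemma additive_functor_wic_embed: "additive_functor \<C> (wic \<C>) (wic_embed_obj \<C>) wic_embed_mor"
proof (intro additive_functor.intro additive_category_wic additive_category_axioms
    additive_functor_axioms.intro)
  show "wic_embed_mor A B \<in> hom (Hom \<C> A B) (Hom (wic \<C>) (wic_embed_obj \<C> A) (wic_embed_obj \<C> B))"
    if "A \<in> Obj \<C>" "B \<in> Obj \<C>" for A B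
  proof (rule homI)
    show "wic_embed_mor A B f \<in> Mor (wic \<C>) (wic_embed_obj \<C> A) (wic_embed_obj \<C> B)"
      if "f \<in> Mor \<C> A B" for f
      using that \<open>A \<in> Obj \<C>\<close> \<open>B \<in> Obj \<C>\<close> by (simp add: Mor_wic_embed wic_embed_mor_def)
  qed (simp add: wic_simps wic_embed_obj_def wic_embed_mor_def)
qed (simp_all add: split_idempotent_Ident wic_embed_mor_def wic_embed_obj_def wic_simps)

end

lemma (in extriangulated_category) extriangulated_pullback_wic:
  "extriangulated_pullback \<C> E s (wic \<C>) (wic_image \<C>) (wic_image_mor \<C>)"
proof (intro extriangulated_pullback.intro extriangulated_category_axioms
    additive_functor_wic_image extriangulated_pullback_axioms.intro)
  show "\<exists>P\<in>Obj (wic \<C>). wic_image \<C> P = X" if "X \<in> Obj \<C>" for X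
    \<comment> \<open>X is the image of (X, 1), because identities carry the trivial
      splitting.\<close>
    using that wic_embed_obj_closed wic_image_embed by blast
qed (rule wic_image_fully_faithful)

theorem theorem3p27:
  fixes \<C> :: "('o, 'm) add_cat"
    and E :: "('o, 'm, 'e) ext_bifunctor"
    and s :: "('o, 'm, 'e) correspondence"
  assumes "extriangulated_category \<C> E s"
  shows "\<exists>(E' :: ('o \<times> 'm, 'm, 'e) ext_bifunctor) (s' :: ('o \<times> 'm, 'm, 'e) correspondence).
    extriangulated_category (wic \<C>) E' s' \<and>
    extriangulated_functor \<C> E s (wic \<C>) E' s' (wic_embed_obj \<C>) wic_embed_mor"
proof -
  interpret extriangulated_category \<C> E s by (rule assms)
  interpret P: extriangulated_pullback \<C> E s "wic \<C>" "wic_image \<C>" "wic_image_mor \<C>"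
    by (rule extriangulated_pullback_wic)
  \<comment> \<open>\<open>Q\<close> returns an embedded object unchanged, so the extension groups
    at embedded objects are those of \<open>E\<close> and the identity is a well-typed
    transformation.\<close>
  let ?\<Gamma> = "\<lambda>(Z :: 'o) (X :: 'o) (\<delta> :: 'e). \<delta>"
  note emb = wic_embed_obj_closed wic_image_embed wic_image_mor_embed wic_embed_mor_def Mor_wic_embed
  have "ext_nat_trans \<C> E P.E' (wic_embed_obj \<C>) wic_embed_mor ?\<Gamma>"
    unfolding ext_nat_trans_def by (simp add: emb hom_def)
  moreover have "realised_by (wic \<C>) P.E' P.s' (?\<Gamma> Z X \<delta>) (wic_embed_obj \<C> X) (wic_embed_obj \<C> Y)
      (wic_embed_obj \<C> Z) (wic_embed_mor X Y x) (wic_embed_mor Y Z y)"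
    if r: "realised_by \<C> E s \<delta> X Y Z x y" for \<delta> X Y Z x y
    \<comment> \<open>The image under \<open>Q\<close> of an embedded sequence is the sequence
      itself, so the hypothesis is already what has to be shown.\<close>
    using r realised_byD[OF r] by (intro P.realised_by_pullbackI) (simp_all add: emb)
  ultimately have "extriangulated_functor \<C> E s (wic \<C>) P.E' P.s' (wic_embed_obj \<C>) wic_embed_mor"
    by (intro extriangulated_functor.intro assms P.extriangulated_category_pullback
        additive_functor_wic_embed extriangulated_functor_axioms.intro exI[of _ ?\<Gamma>]) auto
  with P.extriangulated_category_pullback show ?thesis by blast
qed

end
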